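(* Let $\mathfrak{g}$ be a solvable super Lie algebra over $k$. For every functional $\lambda\in\mathrm{Hom}(\mathfrak{g},k)$ there exists a polarization of $\mathfrak{g}$ at $\lambda$.
   Context: $k$ is an algebraically closed field of characteristic $0$. A super Lie algebra $\mathfrak{g}=\mathfrak{g}_0\oplus\mathfrak{g}_1$ (always finite dimensional) is a $\mathbb{Z}/2\mathbb{Z}$-graded vector space with a degree-preserving bracket satisfying $[x,y]=-(-1)^{|x||y|}[y,x]$ and $[x,[y,z]]=[[x,y],z]+(-1)^{|x||y|}[y,[x,z]]$ for homogeneous $x,y,z$. It is solvable if its derived series $\mathcal{D}^0(\mathfrak{g})=\mathfrak{g}$, $\mathcal{D}^{i}(\mathfrak{g})=[\mathcal{D}^{i-1}(\mathfrak{g}),\mathcal{D}^{i-1}(\mathfrak{g})]$ reaches $0$. $\mathrm{Hom}(\mathfrak{g},k)$ is the space of linear functionals $\lambda:\mathfrak{g}\to k$ with $\lambda(\mathfrak{g}_1)=0$. Such $\lambda$ defines the even superantisymmetric bilinear form $\langle x,y\rangle_\lambda=\lambda([x,y])$ on $\mathfrak{g}$, with kernel $\mathfrak{g}^\lambda=\{x\in\mathfrak{g}:\lambda([x,\mathfrak{g}])=0\}$. A graded subalgebra $\mathfrak{h}\subseteq\mathfrak{g}$ is subordinate to $\lambda$ if $\lambda([\mathfrak{h},\mathfrak{h}])=0$ and $\mathfrak{h}\supseteq\mathfrak{g}^\lambda$. A polarization of $\mathfrak{g}$ at $\lambda$ is a subalgebra $\mathfrak{h}$ subordinate to $\lambda$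 which is a maximal totally isotropic subspace of $\mathfrak{g}$ with respect to $\langle\ ,\ \rangle_\lambda$, i.e. maximal for inclusion among the graded subspaces on which the form vanishes identically. *)

theory Defs
  imports "HOL-Computational_Algebra.Polynomial" "HOL-Library.Z2"
begin

text \<open>
  Degrees in \<open>\<int>/2\<int>\<close> are elements of the two-element field \<^typ>\<open>bit\<close>, so that degrees add
  modulo 2; \<open>koszul i j\<close> is the sign \<open>(-1)\<close> raised to the power \<open>i j\<close>.
\<close>

definition koszul :: "bit \<Rightarrow> bit \<Rightarrow> 'k::field" where
  "koszul i j = (if i = 1 \<and> j = 1 then - 1 else 1)"

text \<open>
  The underlying vector space is the whole type \<open>'v\<close>; \<open>gr i\<close> is its homogeneous part of
  degree \<open>i\<close>.
\<close>

locale super_lie_algebra = vector_space scale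
  for scale :: "'k::field \<Rightarrow> 'v::ab_group_add \<Rightarrow> 'v" +
  fixes gr :: "bit \<Rightarrow> 'v set"
    and bracket :: "'v \<Rightarrow> 'v \<Rightarrow> 'v"
  assumes finite_dim: "\<exists>B. finite B \<and> span B = UNIV"
    and subspace_gr: "subspace (gr i)"
    and gr_inter: "gr 0 \<inter> gr 1 = {0}"
    and gr_sum: "\<exists>a\<in>gr 0. \<exists>b\<in>gr 1. x = a + b"
    and bracket_linear_left: "Vector_Spaces.linear scale scale (\<lambda>x. bracket x y)"
    and bracket_linear_right: "Vector_Spaces.linear scale scale (\<lambda>y. bracket x y)"
    and bracket_gr: "x \<in> gr i \<Longrightarrow> y \<in> gr j \<Longrightarrow> bracket x y \<in> gr (i + j)"
    and bracket_antisym: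
      "x \<in> gr i \<Longrightarrow> y \<in> gr j \<Longrightarrow> bracket x y = scale (- koszul i j) (bracket y x)"
    and bracket_jacobi:
      "x \<in> gr i \<Longrightarrow> y \<in> gr j \<Longrightarrow> z \<in> gr l \<Longrightarrow>
         bracket x (bracket y z) =
           bracket (bracket x y) z + scale (koszul i j) (bracket y (bracket x z))"
begin

definition commutator :: "'v set \<Rightarrow> 'v set \<Rightarrow> 'v set" where
  "commutator A B = span {bracket x y | x y. x \<in> A \<and> y \<in> B}"

primrec derived :: "nat \<Rightarrow> 'v set" where
  "derived 0 = UNIV"
| "derived (Suc n) = commutator (derived n) (derived n)"

definition solvable :: bool where
  "solvable \<longleftrightarrow> (\<exists>n. derived n = {0})"

definition functionals :: "('v \<Rightarrow> 'k) set" where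
  "functionals = {f. Vector_Spaces.linear scale (*) f \<and> (\<forall>x\<in>gr 1. f x = 0)}"

definition form :: "('v \<Rightarrow> 'k) \<Rightarrow> 'v \<Rightarrow> 'v \<Rightarrow> 'k" where
  "form \<phi> x y = \<phi> (bracket x y)"

definition form_kernel :: "('v \<Rightarrow> 'k) \<Rightarrow> 'v set" where
  "form_kernel \<phi> = {x. \<forall>y. form \<phi> x y = 0}"

definition graded_subspace :: "'v set \<Rightarrow> bool" where
  "graded_subspace W \<longleftrightarrow>
     subspace W \<and> (\<forall>w\<in>W. \<exists>a\<in>W \<inter> gr 0. \<exists>b\<in>W \<inter> gr 1. w = a + b)"

definition graded_subalgebra :: "'v set \<Rightarrow> bool" where
  "graded_subalgebra H \<longleftrightarrow> graded_subspace H \<and> (\<forall>x\<in>H. \<forall>y\<in>H. bracket x y \<in> H)"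

definition subordinate :: "('v \<Rightarrow> 'k) \<Rightarrow> 'v set \<Rightarrow> bool" where
  "subordinate \<phi> H \<longleftrightarrow>
     graded_subalgebra H \<and> (\<forall>z\<in>commutator H H. \<phi> z = 0) \<and> form_kernel \<phi> \<subseteq> H"

definition totally_isotropic :: "('v \<Rightarrow> 'k) \<Rightarrow> 'v set \<Rightarrow> bool" where
  "totally_isotropic \<phi> W \<longleftrightarrow> graded_subspace W \<and> (\<forall>x\<in>W. \<forall>y\<in>W. form \<phi> x y = 0)"

definition maximal_totally_isotropic :: "('v \<Rightarrow> 'k) \<Rightarrow> 'v set \<Rightarrow> bool" where
  "maximal_totally_isotropic \<phi> W \<longleftrightarrow>
     totally_isotropic \<phi> W \<and> (\<forall>W'. totally_isotropic \<phi> W' \<and> W \<subseteq> W' \<longrightarrow> W' = W)"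

definition polarization :: "('v \<Rightarrow> 'k) \<Rightarrow> 'v set \<Rightarrow> bool" where
  "polarization \<phi> H \<longleftrightarrow> subordinate \<phi> H \<and> maximal_totally_isotropic \<phi> H"

end

end

theory Submission
  imports Defs
begin

text \<open>
  Write \<open>\<langle>x, y\<rangle> = \<phi> [x, y]\<close>, and call a subspace isotropic if this form vanishes on it. The classical
  construction of polarizations sums the kernels of \<open>\<phi>\<close> along a full flag of ideals. For super
  algebras Lie's theorem fails and such flags need not exist, so the argument runs by induction on
  the dimension of a graded subalgebra \<open>L\<close>, and isolates the one place where a substitute for Lie's
  theorem is needed.

  Let \<open>A\<close> be maximal among the isotropic graded ideals of \<open>L\<close>, and let \<open>P\<close> be its orthogonal in \<open>L\<close>,
  which is a subalgebra. If \<open>P \<noteq> L\<close>, take by induction a polarization \<open>H\<close> of \<open>P\<close>. It contains \<open>A\<close>,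
  because \<open>A\<close> is in the radical of \<open>P\<close>; hence every isotropic subspace of \<open>L\<close> that contains \<open>H\<close> is
  orthogonal to \<open>A\<close>, so lies in \<open>P\<close> and equals \<open>H\<close>. This is \<open>ex_polarization_in\<close>; no dimension count
  is needed, maximality being tested inside \<open>P\<close>.

  If \<open>P = L\<close>, that is, if \<open>A\<close> lies in the radical of \<open>L\<close>, then \<open>A\<close> is itself a polarization
  (\<open>polarization_in_radical_ideal\<close>): either \<open>A = L\<close>, or \<open>L = A \<oplus> k\<theta>\<close> with \<open>\<theta>\<close> odd and
  \<open>\<langle>\<theta>, \<theta>\<rangle> \<noteq> 0\<close>. The reason is that any chief factor \<open>B/A\<close> of \<open>L\<close> above \<open>A\<close> is centralized by \<open>L\<close>
  (\<open>factor_central\<close>), although irreducible modules of solvable super algebras may well have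
  dimension greater than one. What forces this is that \<open>B/A\<close> carries the form, which is nondegenerate
  (maximality of \<open>A\<close>) and invariant. Suppose \<open>L\<close> does not act trivially. Solvability gives an ideal
  \<open>I\<close> of \<open>L\<close> whose image in \<open>gl(B/A)\<close> is abelian and nonzero. An even element \<open>x\<close> of \<open>I\<close> commutes with
  \<open>[x, L]\<close> on \<open>B/A\<close>, so its generalized eigenspaces are submodules, so it has only one eigenvalue \<open>\<mu>\<close>;
  since \<open>x\<close> is skew for the form, \<open>-\<mu>\<close> is an eigenvalue too, and \<open>\<mu> = 0\<close>
  (\<open>even_nilpotent_on_factor\<close>). An odd element of \<open>I\<close> squares to zero on \<open>B/A\<close>. Hence \<open>I\<close> acts by
  supercommuting nilpotent operators, which have a common null vector; the space of these null
  vectors is a submodule, so \<open>I\<close> acts trivially after all (\<open>subset_centralizer\<close>).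
\<close>

section \<open>Eigenvectors modulo a subspace\<close>

text \<open>
  The vector \<open>p(T) v\<close>, by Horner's rule, so that recursion over \<^const>\<open>pCons\<close> is immediate.
\<close>

definition (in vector_space) poly_apply :: "('b \<Rightarrow> 'b) \<Rightarrow> 'b \<Rightarrow> 'a poly \<Rightarrow> 'b" where
  "poly_apply T v p = fold_coeffs (\<lambda>c u. scale c v + T u) p 0"

context vector_space
begin

lemma poly_apply_0 [simp]: "poly_apply T v 0 = 0"
  by (simp add: poly_apply_def)

context
  fixes T :: "'b \<Rightarrow> 'b"
  assumes T: "Vector_Spaces.linear scale scale T"
begin

private lemma T_simps: "T (x + y) = T x + T y" "T (scale c x) = scale c (T x)" "T 0 = 0"
proof -
  show "T (x + y) = T x + T y" "T (scale c x) = scale c (T x)" for x y c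
    using T by (auto simp: Vector_Spaces.linear_iff)
  from this(2)[of 0 0] show "T 0 = 0" by simp
qed

lemma poly_apply_pCons [simp]: "poly_apply T v (pCons c p) = scale c v + T (poly_apply T v p)"
  by (cases "c = 0 \<and> p = 0") (auto simp: poly_apply_def T_simps)

lemma poly_apply_add: "poly_apply T v (p + q) = poly_apply T v p + poly_apply T v q"
  by (induction p q rule: poly_induct2) (simp_all add: T_simps scale_left_distrib)

lemma poly_apply_smult: "poly_apply T v (smult c p) = scale c (poly_apply T v p)"
  by (induction p) (simp_all add: T_simps scale_right_distrib)

lemma poly_apply_monom: "poly_apply T v (monom c i) = scale c ((T ^^ i) v)"
  by (induction i) (simp_all add: T_simps monom_0 monom_Suc)

lemma poly_apply_sum: "poly_apply T v (\<Sum>i\<in>I. p i) = (\<Sum>i\<in>I. poly_apply T v (p i))"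
  by (induction I rule: infinite_finite_induct) (simp_all add: poly_apply_add)

lemma poly_apply_linear_factor:
  "poly_apply T v ([:- \<mu>, 1:] * q) = T (poly_apply T v q) - scale \<mu> (poly_apply T v q)"
proof -
  have "[:- \<mu>, 1:] * q = pCons 0 q + smult (- \<mu>) q"
    by simp
  then show ?thesis
    by (simp only: poly_apply_add poly_apply_smult poly_apply_pCons) simp
qed

lemma poly_apply_mem: "subspace B \<Longrightarrow> T ` B \<subseteq> B \<Longrightarrow> v \<in> B \<Longrightarrow> poly_apply T v p \<in> B"
  by (induction p) (auto simp: subspace_0 subspace_add subspace_scale)

end

end

text \<open>
  The iterates \<open>T\<^sup>i v\<close> are infinitely many vectors in a finite-dimensional space unless two of
  them coincide, and either way they satisfy a nontrivial linear relation.
\<close>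

lemma (in finite_dimensional_vector_space) ex_annihilating_poly:
  assumes T: "Vector_Spaces.linear scale scale T"
  obtains p where "p \<noteq> 0" "poly_apply T v p = 0"
proof (cases "inj (\<lambda>i. (T ^^ i) v)")
  case False
  then obtain i j where ij: "i \<noteq> j" "(T ^^ i) v = (T ^^ j) v"
    by (auto simp: inj_def)
  have "poly_apply T v (monom 1 i + monom (- 1) j) = 0"
    using ij(2) by (simp add: poly_apply_add[OF T] poly_apply_monom[OF T])
  moreover have "coeff (monom 1 i + monom (- 1) j :: 'a poly) i = 1"
    using ij(1) by simp
  then have "monom 1 i + monom (- 1) j \<noteq> (0 :: 'a poly)"
    by (metis coeff_0 zero_neq_one)
  ultimately show ?thesis using that by blast
next
  case inj: True
  let ?f = "\<lambda>i. (T ^^ i) v"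
  have "infinite (range ?f)"
    using inj range_inj_infinite by blast
  then have "dependent (range ?f)"
    using finiteI_independent by blast
  then obtain S u w where S: "finite S" "S \<subseteq> range ?f" "(\<Sum>x\<in>S. scale (u x) x) = 0"
    and w: "w \<in> S" "u w \<noteq> 0"
    unfolding dependent_explicit by blast
  define I where "I = ?f -` S"
  define p where "p = (\<Sum>i\<in>I. monom (u (?f i)) i)"
  have I: "finite I" "?f ` I = S" "inj_on ?f I"
    using S(1,2) inj by (auto simp: I_def finite_vimageI intro: inj_on_subset)
  have "poly_apply T v p = (\<Sum>i\<in>I. scale (u (?f i)) (?f i))"
    by (simp add: p_def poly_apply_sum[OF T] poly_apply_monom[OF T])
  also have "\<dots> = (\<Sum>x\<in>?f ` I. scale (u x) x)"
    using I(3) by (simp add: sum.reindex)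
  finally have "poly_apply T v p = 0"
    using S(3) I(2) by simp
  moreover obtain j where j: "j \<in> I" "?f j = w"
    using w(1) I(2) by auto
  have "coeff p j = (\<Sum>i\<in>I. if i = j then u (?f i) else 0)"
    by (simp add: p_def coeff_sum)
  then have "coeff p j = u w"
    using j I(1) by simp
  then have "p \<noteq> 0"
    using w(2) by auto
  ultimately show ?thesis using that by blast
qed

text \<open>
  An eigenvector of \<open>T\<close> on \<open>B/A\<close>, without forming the quotient: take \<open>v\<close> in \<open>B\<close> outside \<open>A\<close> and a
  polynomial \<open>p \<noteq> 0\<close> of least degree with \<open>p(T) v \<in> A\<close>. If \<open>\<mu>\<close> is a root of \<open>p = (X - \<mu>) q\<close>, then
  \<open>q(T) v\<close> is outside \<open>A\<close> and is mapped into \<open>A\<close> by \<open>T - \<mu>\<close>.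
\<close>

lemma ex_eigenvector_modulo:
  fixes scale :: "'k::alg_closed_field \<Rightarrow> 'v::ab_group_add \<Rightarrow> 'v"
  assumes fin: "finite_dimensional_vector_space scale Basis"
    and T: "Vector_Spaces.linear scale scale T"
    and A: "module.subspace scale A" and B: "module.subspace scale B" "T ` B \<subseteq> B"
    and AB: "\<not> B \<subseteq> A"
  obtains \<mu> w where "w \<in> B" "w \<notin> A" "T w - scale \<mu> w \<in> A"
proof -
  interpret finite_dimensional_vector_space scale Basis by (fact fin)
  obtain v where v: "v \<in> B" "v \<notin> A" using AB by blast
  obtain p0 where "p0 \<noteq> 0" "poly_apply T v p0 = 0"
    using ex_annihilating_poly[OF T] by blast
  then have "\<exists>p. p \<noteq> 0 \<and> poly_apply T v p \<in> A"
    using subspace_0[OF A] by auto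
  then obtain p where p: "p \<noteq> 0" "poly_apply T v p \<in> A"
    and least: "\<And>q. q \<noteq> 0 \<Longrightarrow> poly_apply T v q \<in> A \<Longrightarrow> degree p \<le> degree q"
    using ex_has_least_nat[of "\<lambda>p. p \<noteq> 0 \<and> poly_apply T v p \<in> A" _ degree] by meson
  have "degree p > 0"
  proof (rule ccontr)
    assume "\<not> degree p > 0"
    then obtain c where c: "p = [:c:]"
      using degree_eq_zeroE by blast
    have "T (scale 0 0) = scale 0 (T 0)"
      using T unfolding Vector_Spaces.linear_iff by blast
    then have "poly_apply T v p = scale c v"
      by (simp add: c poly_apply_pCons[OF T])
    with p c have c0: "c \<noteq> 0" and "scale c v \<in> A"
      by auto
    then have "scale (inverse c) (scale c v) \<in> A"
      using subspace_scale[OF A] by blast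
    with v(2) c0 show False by simp
  qed
  then obtain \<mu> where "poly p \<mu> = 0"
    using alg_closed_imp_poly_has_root[of p] by blast
  then obtain q where q: "p = [:- \<mu>, 1:] * q"
    by (auto simp: poly_eq_0_iff_dvd)
  with p(1) have "q \<noteq> 0" by auto
  moreover from this have "degree p = Suc (degree q)"
    unfolding q by (subst degree_mult_eq) simp_all
  ultimately have "poly_apply T v q \<notin> A"
    using least[of q] by auto
  moreover have "poly_apply T v q \<in> B"
    using B v by (intro poly_apply_mem[OF T])
  ultimately show ?thesis
    using that p(2) unfolding q poly_apply_linear_factor[OF T] by blast
qed

section \<open>Graded subspaces and ideals of a super Lie algebra\<close>

context super_lie_algebra
begin

lemma bracket_add_left: "bracket (x + x') y = bracket x y + bracket x' y"
  and bracket_scale_left: "bracket (scale c x) y = scale c (bracket x y)"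
  using bracket_linear_left[of y] by (auto simp: Vector_Spaces.linear_iff)

lemma bracket_add_right: "bracket x (y + y') = bracket x y + bracket x y'"
  and bracket_scale_right: "bracket x (scale c y) = scale c (bracket x y)"
  using bracket_linear_right[of x] by (auto simp: Vector_Spaces.linear_iff)

lemma bracket_zero_left [simp]: "bracket 0 y = 0"
  using bracket_scale_left[of 0 0 y] by simp

lemma bracket_zero_right [simp]: "bracket x 0 = 0"
  using bracket_scale_right[of x 0 0] by simp

lemma bracket_diff_left: "bracket (x - x') y = bracket x y - bracket x' y"
  using bracket_add_left[of "x - x'" x' y] by simp

lemma bracket_diff_right: "bracket x (y - y') = bracket x y - bracket x y'"
  using bracket_add_right[of x "y - y'" y'] by simp

lemma obtain_finite_basis:
  obtains B where "finite_dimensional_vector_space scale B"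
proof -
  obtain S where S: "finite S" "span S = UNIV"
    using finite_dim by auto
  obtain B where B: "B \<subseteq> S" "independent B" "S \<subseteq> span B"
    using maximal_independent_subset[of S] by metis
  have "span B = UNIV"
    using S(2) B(3) span_minimal[of S "span B"] by auto
  then have "finite_dimensional_vector_space scale B"
    using B S(1) finite_subset[of B S] by unfold_locales auto
  then show ?thesis by (rule that)
qed

lemma independent_finite: "independent B \<Longrightarrow> finite B"
  using obtain_finite_basis finite_dimensional_vector_space.finiteI_independent by blast

lemma dim_less_if_psubset:
  assumes "subspace A" "subspace B" "A \<subset> B"
  shows "dim A < dim B"
proof -
  obtain S where "finite_dimensional_vector_space scale S"
    by (rule obtain_finite_basis)
  then interpret finite_dimensional_vector_space scale S .
  show ?thesis
    using assms dim_psubset[of A B] by (metis span_eq_iff)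
qed

lemma dim_le_dim_UNIV: "dim A \<le> dim UNIV"
proof -
  obtain S where "finite_dimensional_vector_space scale S"
    by (rule obtain_finite_basis)
  then interpret finite_dimensional_vector_space scale S .
  show ?thesis by (rule dim_subset) simp
qed

lemma ex_maximal_subspace:
  assumes "P A" and "\<And>M. P M \<Longrightarrow> subspace M"
  obtains M where "P M" and "A \<subseteq> M" and "\<And>N. P N \<Longrightarrow> M \<subseteq> N \<Longrightarrow> N = M"
proof -
  have "\<exists>M. (P M \<and> A \<subseteq> M) \<and> (\<forall>N. P N \<and> A \<subseteq> N \<longrightarrow> dim N \<le> dim M)"
    using assms(1) dim_le_dim_UNIV
    by (intro ex_has_greatest_nat[where k = A and b = "Suc (dim UNIV)"]) (auto simp: less_Suc_eq_le)
  then obtain M where M: "P M" "A \<subseteq> M" "\<And>N. P N \<Longrightarrow> A \<subseteq> N \<Longrightarrow> dim N \<le> dim M"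
    by blast
  have "N = M" if "P N" "M \<subseteq> N" for N
    using that M(1) M(2) M(3)[of N] dim_less_if_psubset[of M N] assms(2) by fastforce
  with M(1,2) show ?thesis by (rule that)
qed

lemma ex_minimal_subspace:
  assumes "P A" and "\<And>M. P M \<Longrightarrow> subspace M"
  obtains M where "P M" and "\<And>N. P N \<Longrightarrow> N \<subseteq> M \<Longrightarrow> N = M"
proof -
  obtain M where M: "P M" "\<And>N. P N \<Longrightarrow> dim M \<le> dim N"
    using ex_has_least_nat[of P A dim] assms(1) by blast
  have "N = M" if "P N" "N \<subseteq> M" for N
    using that M(1) M(2)[of N] dim_less_if_psubset[of N M] assms(2) by fastforce
  with M(1) show ?thesis by (rule that)
qed

lemma mem_span_insert_subspace:
  "subspace A \<Longrightarrow> x \<in> span (insert w A) \<longleftrightarrow> (\<exists>t. x - scale t w \<in> A)"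
  by (simp add: span_breakdown_eq span_eq_iff[THEN iffD2])


definition even_part :: "'v \<Rightarrow> 'v" where
  "even_part x = (THE a. a \<in> gr 0 \<and> x - a \<in> gr 1)"

lemma even_part_eqI:
  assumes "a \<in> gr 0" "x - a \<in> gr 1"
  shows "even_part x = a"
  unfolding even_part_def
proof (rule the_equality)
  fix c assume c: "c \<in> gr 0 \<and> x - c \<in> gr 1"
  have "c - a \<in> gr 0"
    using c assms by (simp add: subspace_diff subspace_gr)
  moreover have "c - a \<in> gr 1"
    using subspace_diff[OF subspace_gr assms(2), of "x - c"] c by simp
  ultimately have "c - a \<in> {0}"
    unfolding gr_inter[symmetric] by blast
  then show "c = a" by simp
qed (use assms in simp)

lemma even_part_even: "even_part x \<in> gr 0"
  and odd_part_odd: "x - even_part x \<in> gr 1"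
proof -
  obtain a b where "a \<in> gr 0" "b \<in> gr 1" "x = a + b"
    using gr_sum[of x] by blast
  then show "even_part x \<in> gr 0" "x - even_part x \<in> gr 1"
    using even_part_eqI[of a x] by auto
qed

lemma even_part_of_even: "x \<in> gr 0 \<Longrightarrow> even_part x = x"
  by (rule even_part_eqI) (auto simp: subspace_0 subspace_gr)

lemma even_part_of_odd: "x \<in> gr 1 \<Longrightarrow> even_part x = 0"
  by (rule even_part_eqI) (auto simp: subspace_0 subspace_gr)

lemma even_part_add: "even_part (x + y) = even_part x + even_part y"
proof (rule even_part_eqI)
  show "x + y - (even_part x + even_part y) \<in> gr 1"
    using subspace_add[OF subspace_gr odd_part_odd odd_part_odd, of x y] by (simp add: algebra_simps)
qed (simp add: even_part_even subspace_add subspace_gr)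

lemma even_part_scale: "even_part (scale c x) = scale c (even_part x)"
proof (rule even_part_eqI)
  show "scale c x - scale c (even_part x) \<in> gr 1"
    using subspace_scale[OF subspace_gr odd_part_odd, of c x] by (simp add: scale_right_diff_distrib)
qed (simp add: even_part_even subspace_scale subspace_gr)

lemma even_part_diff: "even_part (x - y) = even_part x - even_part y"
  using even_part_add[of "x - y" y] by simp

lemma even_part_bracket:
  "even_part (bracket x y) =
     bracket (even_part x) (even_part y) + bracket (x - even_part x) (y - even_part y)"
proof -
  define p where "p = even_part x"
  define q where "q = x - even_part x"
  define r where "r = even_part y"
  define s where "s = y - even_part y"
  have p: "p \<in> gr 0" and q: "q \<in> gr 1" and r: "r \<in> gr 0" and s: "s \<in> gr 1"
    by (auto simp: p_def q_def r_def s_def even_part_even odd_part_odd)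
  have "bracket x y = (bracket p r + bracket q s) + (bracket p s + bracket q r)"
  proof -
    have "bracket x y = bracket (p + q) (r + s)"
      by (simp add: p_def q_def r_def s_def)
    then show ?thesis
      by (simp only: bracket_add_left bracket_add_right ac_simps)
  qed
  moreover have "bracket p r + bracket q s \<in> gr 0" "bracket p s + bracket q r \<in> gr 1"
    using bracket_gr[OF p r] bracket_gr[OF q s] bracket_gr[OF p s] bracket_gr[OF q r]
    by (simp_all add: subspace_add[OF subspace_gr])
  ultimately have "even_part (bracket x y) = bracket p r + bracket q s"
    by (intro even_part_eqI) simp_all
  then show ?thesis
    by (simp only: p_def q_def r_def s_def)
qed

text \<open>
  Gradedness becomes stability under one linear projection, which makes it easy to check for
  intersections, orthogonals and eigenspaces.
\<close>

lemma graded_subspace_iff_even_part: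
  "graded_subspace W \<longleftrightarrow> subspace W \<and> (\<forall>w\<in>W. even_part w \<in> W)"
proof (intro iffI conjI ballI)
  fix w assume "graded_subspace W" "w \<in> W"
  then obtain a b where w: "a \<in> W" "a \<in> gr 0" "b \<in> gr 1" "w = a + b"
    unfolding graded_subspace_def by blast
  then have "even_part w = a"
    by (intro even_part_eqI) simp_all
  with w(1) show "even_part w \<in> W" by simp
next
  assume W: "subspace W \<and> (\<forall>w\<in>W. even_part w \<in> W)"
  have "even_part w \<in> W \<inter> gr 0" "w - even_part w \<in> W \<inter> gr 1" "w = even_part w + (w - even_part w)"
    if "w \<in> W" for w
    using W that subspace_diff[of W w "even_part w"] by (simp_all add: even_part_even odd_part_odd)
  with W show "graded_subspace W"
    unfolding graded_subspace_def by blast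
qed (simp add: graded_subspace_def)

lemma graded_subspaceD:
  assumes "graded_subspace W"
  shows "subspace W" and "\<And>w. w \<in> W \<Longrightarrow> even_part w \<in> W"
    and "\<And>w. w \<in> W \<Longrightarrow> w - even_part w \<in> W"
  using assms by (simp_all add: graded_subspace_iff_even_part subspace_diff)

lemma graded_subspace_UNIV: "graded_subspace UNIV"
  by (simp add: graded_subspace_iff_even_part)

lemma graded_subspace_Int:
  "graded_subspace A \<Longrightarrow> graded_subspace B \<Longrightarrow> graded_subspace (A \<inter> B)"
  by (auto simp: graded_subspace_iff_even_part subspace_inter)

lemma graded_subspace_sums:
  assumes "graded_subspace A" "graded_subspace B"
  shows "graded_subspace {x + y | x y. x \<in> A \<and> y \<in> B}"
  unfolding graded_subspace_iff_even_part
proof (intro conjI ballI)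
  show "subspace {x + y | x y. x \<in> A \<and> y \<in> B}"
    using assms by (intro subspace_sums graded_subspaceD(1))
  fix w assume "w \<in> {x + y | x y. x \<in> A \<and> y \<in> B}"
  then obtain x y where "w = x + y" "x \<in> A" "y \<in> B" by blast
  then show "even_part w \<in> {x + y | x y. x \<in> A \<and> y \<in> B}"
    using assms graded_subspaceD(2) even_part_add by blast
qed

lemma graded_subspace_insert:
  assumes A: "graded_subspace A" and w: "w \<in> gr j"
  shows "graded_subspace (span (insert w A))"
  unfolding graded_subspace_iff_even_part
proof (intro conjI ballI)
  fix x assume "x \<in> span (insert w A)"
  then obtain t where t: "x - scale t w \<in> A"
    using A by (auto simp: mem_span_insert_subspace graded_subspaceD)
  have "even_part x - scale t (even_part w) \<in> A"
    using graded_subspaceD(2)[OF A t] by (simp add: even_part_diff even_part_scale)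
  moreover have "\<exists>s. scale t (even_part w) = scale s w"
  proof (cases "j = 0")
    case True
    with w show ?thesis by (auto simp: even_part_of_even)
  next
    case False
    with w have "scale t (even_part w) = scale 0 w" by (simp add: even_part_of_odd)
    then show ?thesis ..
  qed
  ultimately show "even_part x \<in> span (insert w A)"
    using A by (auto simp: mem_span_insert_subspace graded_subspaceD)
qed simp

text \<open>
  The axioms of a super Lie algebra hold for homogeneous elements only, because of the signs. For
  membership in a subspace signs do not matter, so the following lemmas restate
  antisymmetry and the Jacobi identity as sign-free membership rules for all elements of graded
  subspaces.
\<close>

lemma bilinear_mem_if_homogeneous:
  assumes A: "graded_subspace A" and B: "graded_subspace B" and W: "subspace W"
    and f: "\<And>x x' y. f (x + x') y = f x y + f x' y" "\<And>x y y'. f x (y + y') = f x y + f x y'"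
    and hom: "\<And>i j x y. x \<in> A \<Longrightarrow> x \<in> gr i \<Longrightarrow> y \<in> B \<Longrightarrow> y \<in> gr j \<Longrightarrow> f x y \<in> W"
    and "x \<in> A" "y \<in> B"
  shows "f x y \<in> W"
proof -
  define p where "p = even_part x"
  define q where "q = x - even_part x"
  define r where "r = even_part y"
  define s where "s = y - even_part y"
  have pq: "p \<in> A" "q \<in> A" "p \<in> gr 0" "q \<in> gr 1"
    and rs: "r \<in> B" "s \<in> B" "r \<in> gr 0" "s \<in> gr 1"
    using graded_subspaceD[OF A] graded_subspaceD[OF B] \<open>x \<in> A\<close> \<open>y \<in> B\<close>
    by (auto simp: p_def q_def r_def s_def even_part_even odd_part_odd)
  have "f x y = (f p r + f p s) + (f q r + f q s)"
    unfolding f[symmetric] by (simp add: p_def q_def r_def s_def)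
  also have "\<dots> \<in> W"
    using pq rs W by (intro subspace_add) (auto intro: hom)
  finally show ?thesis .
qed

lemma bracket_swap_mem:
  assumes "graded_subspace A" "graded_subspace B" "subspace W"
    and "\<And>x y. x \<in> A \<Longrightarrow> y \<in> B \<Longrightarrow> bracket x y \<in> W" and "y \<in> B" "x \<in> A"
  shows "bracket y x \<in> W"
proof (rule bilinear_mem_if_homogeneous[where f = bracket])
  fix i j x y assume "x \<in> B" "x \<in> gr i" "y \<in> A" "y \<in> gr j"
  then show "bracket x y \<in> W"
    using assms bracket_antisym[of x i y j] by (simp add: subspace_scale subspace_neg)
qed (use assms in \<open>auto simp: bracket_add_left bracket_add_right\<close>)

lemma jacobi:
  assumes x: "x \<in> gr i" and y: "y \<in> gr j"
  shows "bracket x (bracket y z) =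
    bracket (bracket x y) z + scale (koszul i j) (bracket y (bracket x z))"
proof -
  define p where "p = even_part z"
  define q where "q = z - even_part z"
  have z: "z = p + q" and pq: "p \<in> gr 0" "q \<in> gr 1"
    by (auto simp: p_def q_def even_part_even odd_part_odd)
  show ?thesis
    unfolding z using bracket_jacobi[OF x y pq(1)] bracket_jacobi[OF x y pq(2)]
    by (simp add: bracket_add_right scale_right_distrib algebra_simps)
qed

text \<open>
  Even elements act as ordinary derivations: every sign involving them is \<open>+1\<close>.
\<close>

lemma bracket_even_derivation:
  assumes "x \<in> gr 0"
  shows "bracket x (bracket y z) = bracket (bracket x y) z + bracket y (bracket x z)"
proof -
  have "bracket x (bracket y z) - (bracket (bracket x y) z + bracket y (bracket x z)) \<in> {0}"
    by (rule bilinear_mem_if_homogeneous[OF graded_subspace_UNIV graded_subspace_UNIV,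
          where x = y and y = z])
      (use jacobi[OF assms] in
        \<open>auto simp: bracket_add_left bracket_add_right koszul_def algebra_simps\<close>)
  then show ?thesis by simp
qed

lemma nested_bracket_right_mem:
  assumes A: "graded_subspace A" and B: "graded_subspace B" and W: "subspace W"
    and "\<And>x y. x \<in> A \<Longrightarrow> y \<in> B \<Longrightarrow> bracket (bracket x y) z \<in> W"
    and "\<And>x y. x \<in> A \<Longrightarrow> y \<in> B \<Longrightarrow> bracket y (bracket x z) \<in> W"
    and "x \<in> A" "y \<in> B"
  shows "bracket x (bracket y z) \<in> W"
proof (rule bilinear_mem_if_homogeneous[where f = "\<lambda>x y. bracket x (bracket y z)", OF A B W])
  fix i j x y assume "x \<in> A" "x \<in> gr i" "y \<in> B" "y \<in> gr j"
  then show "bracket x (bracket y z) \<in> W"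
    using assms jacobi[of x i y j z] by (simp add: subspace_add subspace_scale)
qed (use assms in \<open>auto simp: bracket_add_left bracket_add_right\<close>)

lemma nested_bracket_left_mem:
  assumes A: "graded_subspace A" and B: "graded_subspace B" and W: "subspace W"
    and "\<And>x y. x \<in> A \<Longrightarrow> y \<in> B \<Longrightarrow> bracket x (bracket y z) \<in> W"
    and "\<And>x y. x \<in> A \<Longrightarrow> y \<in> B \<Longrightarrow> bracket y (bracket x z) \<in> W"
    and "x \<in> A" "y \<in> B"
  shows "bracket (bracket x y) z \<in> W"
proof (rule bilinear_mem_if_homogeneous[where f = "\<lambda>x y. bracket (bracket x y) z", OF A B W])
  fix i j x y assume xy: "x \<in> A" "x \<in> gr i" "y \<in> B" "y \<in> gr j"
  then have "bracket (bracket x y) z =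
      bracket x (bracket y z) - scale (koszul i j) (bracket y (bracket x z))"
    using jacobi[of x i y j z] by simp
  then show "bracket (bracket x y) z \<in> W"
    using assms xy by (simp add: subspace_diff subspace_scale)
qed (use assms in \<open>auto simp: bracket_add_left bracket_add_right\<close>)

text \<open>
  The even part of \<open>v\<close> is controlled by brackets with homogeneous \<open>x\<close>: the vector \<open>[x, even_part v]\<close>
  is the even part of \<open>[x, v]\<close> for even \<open>x\<close>, and its odd part for odd \<open>x\<close>.
\<close>

lemma graded_subspace_transporter:
  assumes I: "graded_subspace I" and B: "graded_subspace B" and A: "graded_subspace A"
  shows "graded_subspace {v \<in> B. \<forall>x\<in>I. bracket x v \<in> A}"
  unfolding graded_subspace_iff_even_part
proof (intro conjI ballI)
  show "subspace {v \<in> B. \<forall>x\<in>I. bracket x v \<in> A}"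
    using graded_subspaceD(1)[OF A] graded_subspaceD(1)[OF B]
    by (auto simp: bracket_add_right bracket_scale_right subspace_0 subspace_add subspace_scale
        intro!: subspaceI)
  fix v assume v: "v \<in> {v \<in> B. \<forall>x\<in>I. bracket x v \<in> A}"
  have "bracket x (even_part v) \<in> A" if x: "x \<in> I" for x
  proof -
    define p where "p = even_part x"
    define q where "q = x - even_part x"
    have p: "p \<in> I" "p \<in> gr 0" and q: "q \<in> I" "q \<in> gr 1" and x_eq: "x = p + q"
      using x graded_subspaceD[OF I] by (auto simp: p_def q_def even_part_even odd_part_odd)
    have "even_part (bracket p v) = bracket p (even_part v)"
      using p by (simp add: even_part_bracket even_part_of_even)
    moreover have "bracket q v - even_part (bracket q v) = bracket q (even_part v)"
      using q by (simp add: even_part_bracket even_part_of_odd bracket_diff_right)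
    moreover have "even_part (bracket p v) \<in> A" "bracket q v - even_part (bracket q v) \<in> A"
      using v p q graded_subspaceD(2,3)[OF A] by auto
    ultimately show ?thesis
      using graded_subspaceD(1)[OF A] by (simp add: x_eq bracket_add_left subspace_add)
  qed
  with v show "even_part v \<in> {v \<in> B. \<forall>x\<in>I. bracket x v \<in> A}"
    using graded_subspaceD(2)[OF B] by auto
qed

lemma finite_homogeneous_spanning_set:
  assumes "graded_subspace I"
  obtains F where "finite F" "F \<subseteq> I" "\<And>x. x \<in> F \<Longrightarrow> \<exists>i. x \<in> gr i" "I \<subseteq> span F"
proof -
  obtain D0 where D0: "D0 \<subseteq> I \<inter> gr 0" "independent D0" "I \<inter> gr 0 \<subseteq> span D0"
    by (rule maximal_independent_subset)
  obtain D1 where D1: "D1 \<subseteq> I \<inter> gr 1" "independent D1" "I \<inter> gr 1 \<subseteq> span D1"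
    by (rule maximal_independent_subset)
  have "x \<in> span (D0 \<union> D1)" if x: "x \<in> I" for x
  proof -
    have "even_part x \<in> span D0" "x - even_part x \<in> span D1"
      using x D0(3) D1(3) graded_subspaceD[OF assms] even_part_even odd_part_odd by auto
    then have "even_part x + (x - even_part x) \<in> span (D0 \<union> D1)"
      using span_mono[of D0 "D0 \<union> D1"] span_mono[of D1 "D0 \<union> D1"] by (intro span_add) auto
    then show ?thesis by simp
  qed
  moreover have "finite (D0 \<union> D1)"
    using D0(2) D1(2) independent_finite by simp
  ultimately show ?thesis
    using D0(1) D1(1) by (intro that[of "D0 \<union> D1"]) auto
qed

definition ideal_of :: "'v set \<Rightarrow> 'v set \<Rightarrow> bool" where
  "ideal_of L A \<longleftrightarrow> graded_subspace A \<and> A \<subseteq> L \<and> (\<forall>x\<in>L. \<forall>y\<in>A. bracket x y \<in> A)"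

lemma ideal_ofD:
  assumes "ideal_of L A"
  shows "graded_subspace A" "subspace A" "A \<subseteq> L"
    and "\<And>x y. x \<in> L \<Longrightarrow> y \<in> A \<Longrightarrow> bracket x y \<in> A"
  using assms by (auto simp: ideal_of_def graded_subspace_def)

lemma ideal_of_bracket_right:
  assumes "graded_subspace L" "ideal_of L A" "y \<in> A" "x \<in> L"
  shows "bracket y x \<in> A"
  using assms ideal_ofD[OF assms(2)] bracket_swap_mem[of L A A] by auto

lemma ideal_of_Int: "ideal_of L A \<Longrightarrow> ideal_of L B \<Longrightarrow> ideal_of L (A \<inter> B)"
  by (auto simp: ideal_of_def graded_subspace_Int)

lemma ideal_of_sums:
  assumes "subspace L" "ideal_of L A" "ideal_of L B"
  shows "ideal_of L {x + y | x y. x \<in> A \<and> y \<in> B}"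
  unfolding ideal_of_def
proof (intro conjI ballI)
  fix x y assume x: "x \<in> L" and "y \<in> {x + y | x y. x \<in> A \<and> y \<in> B}"
  then obtain u v where "y = u + v" "u \<in> A" "v \<in> B" by auto
  then have "bracket x y = bracket x u + bracket x v" "bracket x u \<in> A" "bracket x v \<in> B"
    using x assms by (auto simp: bracket_add_right ideal_of_def)
  then show "bracket x y \<in> {x + y | x y. x \<in> A \<and> y \<in> B}"
    by blast
next
  show "{x + y | x y. x \<in> A \<and> y \<in> B} \<subseteq> L"
    using assms by (auto simp: ideal_of_def intro!: subspace_add)
qed (use assms in \<open>auto simp: ideal_of_def graded_subspace_sums\<close>)

lemma ideal_of_insert:
  assumes L: "subspace L" and A: "ideal_of L A" and w: "w \<in> L" "w \<in> gr j"
    and central: "\<And>x. x \<in> L \<Longrightarrow> bracket x w \<in> A"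
  shows "ideal_of L (span (insert w A))"
  unfolding ideal_of_def
proof (intro conjI ballI)
  note A' = ideal_ofD[OF A]
  show "graded_subspace (span (insert w A))"
    using A'(1) w(2) by (rule graded_subspace_insert)
  show "span (insert w A) \<subseteq> L"
    using A' w L by (intro span_minimal) auto
  fix x y assume x: "x \<in> L" and "y \<in> span (insert w A)"
  then obtain t where "y - scale t w \<in> A"
    using A' by (auto simp: mem_span_insert_subspace)
  then have "bracket x (y - scale t w) + scale t (bracket x w) \<in> A"
    using A' x central by (intro subspace_add subspace_scale) auto
  then have "bracket x y \<in> A"
    by (simp add: bracket_diff_right bracket_scale_right)
  then show "bracket x y \<in> span (insert w A)"
    by (simp add: span_base)
qed

lemma ideal_of_derived: "ideal_of UNIV (derived n)"
proof (induction n)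
  case 0
  show ?case by (simp add: ideal_of_def graded_subspace_UNIV)
next
  case (Suc n)
  note D = ideal_ofD[OF Suc.IH]
  let ?S = "{bracket x y | x y. x \<in> derived n \<and> y \<in> derived n}"
  have step: "bracket x y \<in> span ?S" if "x \<in> derived n" "y \<in> derived n" for x y
    using that by (auto intro: span_base)
  have "even_part w \<in> span ?S" if "w \<in> span ?S" for w
    using that
  proof (rule span_induct)
    show "subspace {w. even_part w \<in> span ?S}"
      by (rule subspaceI)
        (auto simp: even_part_add even_part_scale even_part_of_even subspace_0 subspace_gr
          span_zero span_add span_scale)
    fix w assume "w \<in> ?S"
    then show "even_part w \<in> span ?S"
      using graded_subspaceD[OF D(1)] by (auto simp: even_part_bracket intro!: span_add step)
  qed
  moreover have "bracket z w \<in> span ?S" if "w \<in> span ?S" for z w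
    using that
  proof (rule span_induct)
    show "subspace {w. bracket z w \<in> span ?S}"
      by (rule subspaceI)
        (auto simp: bracket_add_right bracket_scale_right span_zero span_add span_scale)
    fix w assume "w \<in> ?S"
    then obtain x y where w: "w = bracket x y" "x \<in> derived n" "y \<in> derived n"
      by blast
    show "bracket z w \<in> span ?S"
      unfolding w(1)
      by (rule nested_bracket_right_mem[OF graded_subspace_UNIV D(1)])
        (use D(4) w in \<open>auto intro: step\<close>)
  qed
  ultimately show ?case
    by (simp add: ideal_of_def graded_subspace_iff_even_part commutator_def)
qed

lemma ideal_of_derived_Int:
  assumes "graded_subalgebra L"
  shows "ideal_of L (derived n \<inter> L)"
  using assms ideal_of_derived[of n]
  by (auto simp: ideal_of_def graded_subalgebra_def graded_subspace_Int)

lemma bracket_mem_derived_Suc: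
  "x \<in> derived n \<Longrightarrow> y \<in> derived n \<Longrightarrow> bracket x y \<in> derived (Suc n)"
  by (auto simp: commutator_def intro: span_base)

text \<open>
  The use made of solvability: when \<open>A\<close> is an ideal of a subalgebra \<open>L\<close>, the last term of the
  derived series that meets \<open>L\<close> outside \<open>A\<close> gives a nonzero abelian ideal of \<open>L/A\<close>.
  Intersecting the derived series of the whole algebra with \<open>L\<close> avoids introducing the derived series of the subalgebra \<open>L\<close>.
\<close>

lemma last_derived_not_subset:
  assumes solvable "subspace A" "\<not> L \<subseteq> A"
  obtains n where "\<not> derived n \<inter> L \<subseteq> A" "derived (Suc n) \<inter> L \<subseteq> A"
proof -
  obtain m where "derived m = {0}"
    using assms by (auto simp: solvable_def)
  then have m: "derived m \<inter> L \<subseteq> A"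
    using subspace_0[OF assms(2)] by auto
  define k where "k = (LEAST k. derived k \<inter> L \<subseteq> A)"
  have k: "derived k \<inter> L \<subseteq> A"
    unfolding k_def using m by (rule LeastI)
  with assms(3) have "k \<noteq> 0" by (auto intro!: notI)
  then obtain n where "k = Suc n" by (cases k) auto
  moreover from this have "\<not> derived n \<inter> L \<subseteq> A"
    using not_less_Least[of n "\<lambda>k. derived k \<inter> L \<subseteq> A"] by (simp add: k_def)
  ultimately show ?thesis using k that by blast
qed

end

section \<open>The form of a functional\<close>

context super_lie_algebra
begin

definition orthogonal :: "('v \<Rightarrow> 'k) \<Rightarrow> 'v set \<Rightarrow> 'v set" where
  "orthogonal \<phi> A = {x. \<forall>y\<in>A. form \<phi> x y = 0}"

context
  fixes \<phi> :: "'v \<Rightarrow> 'k"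
  assumes \<phi>: "\<phi> \<in> functionals"
begin

lemma functional_simps:
  shows "\<phi> (x + y) = \<phi> x + \<phi> y" "\<phi> (x - y) = \<phi> x - \<phi> y" "\<phi> (scale c x) = c * \<phi> x" "\<phi> 0 = 0"
proof -
  have lin: "Vector_Spaces.linear scale (*) \<phi>"
    using \<phi> by (simp add: functionals_def)
  then show add: "\<phi> (x + y) = \<phi> x + \<phi> y" and sc: "\<phi> (scale c x) = c * \<phi> x" for x y c
    by (auto simp: Vector_Spaces.linear_iff)
  show "\<phi> (x - y) = \<phi> x - \<phi> y"
    using add[of "x - y" y] by simp
  show "\<phi> 0 = 0"
    using sc[of 0 0] by simp
qed

lemma form_simps:
  "form \<phi> (x + x') y = form \<phi> x y + form \<phi> x' y"
  "form \<phi> x (y + y') = form \<phi> x y + form \<phi> x y'"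
  "form \<phi> (x - x') y = form \<phi> x y - form \<phi> x' y"
  "form \<phi> x (y - y') = form \<phi> x y - form \<phi> x y'"
  "form \<phi> (scale c x) y = c * form \<phi> x y"
  "form \<phi> x (scale c y) = c * form \<phi> x y"
  "form \<phi> 0 y = 0" "form \<phi> x 0 = 0"
  by (simp_all add: form_def bracket_add_left bracket_add_right bracket_diff_left
      bracket_diff_right bracket_scale_left bracket_scale_right functional_simps)

lemma functional_even_part: "\<phi> (even_part x) = \<phi> x"
proof -
  have "\<phi> (x - even_part x) = 0"
    using \<phi> odd_part_odd by (auto simp: functionals_def)
  then show ?thesis by (simp add: functional_simps)
qed

lemma subspace_functional_kernel: "subspace {v. \<phi> v = 0}"
  by (rule subspaceI) (simp_all add: functional_simps)

text \<open>
  As \<open>\<phi>\<close> vanishes on odd elements, the form pairs even with even and odd with odd elements only;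
  equivalently the projection onto the even part is self-adjoint.
\<close>

lemma form_even_part_left: "form \<phi> (even_part x) y = form \<phi> x (even_part y)"
proof -
  have "form \<phi> (even_part x) y = \<phi> (bracket (even_part x) (even_part y))"
    unfolding form_def
    by (subst functional_even_part[symmetric])
      (simp add: even_part_bracket even_part_of_even even_part_even)
  moreover have "form \<phi> x (even_part y) = \<phi> (bracket (even_part x) (even_part y))"
    unfolding form_def
    by (subst functional_even_part[symmetric])
      (simp add: even_part_bracket even_part_of_even even_part_even)
  ultimately show ?thesis by simp
qed

lemma graded_subspace_orthogonal:
  assumes "graded_subspace A"
  shows "graded_subspace (orthogonal \<phi> A)"
  unfolding graded_subspace_iff_even_part
  using assms
  by (auto simp: orthogonal_def form_simps form_even_part_left graded_subspaceD intro!: subspaceI)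

lemma form_swap_zero:
  assumes "graded_subspace A" "graded_subspace B"
    and "\<And>x y. x \<in> A \<Longrightarrow> y \<in> B \<Longrightarrow> form \<phi> x y = 0" and "y \<in> B" "x \<in> A"
  shows "form \<phi> y x = 0"
  using bracket_swap_mem[OF assms(1,2) subspace_functional_kernel _ assms(4,5)] assms(3)
  by (simp add: form_def)

lemma form_bracket_left_zero:
  assumes "graded_subspace A" "graded_subspace B"
    and "\<And>x y. x \<in> A \<Longrightarrow> y \<in> B \<Longrightarrow> form \<phi> x (bracket y z) = 0"
    and "\<And>x y. x \<in> A \<Longrightarrow> y \<in> B \<Longrightarrow> form \<phi> y (bracket x z) = 0"
    and "x \<in> A" "y \<in> B"
  shows "form \<phi> (bracket x y) z = 0"
  using nested_bracket_left_mem[OF assms(1,2) subspace_functional_kernel _ _ assms(5,6), of z]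
    assms(3,4)
  by (simp add: form_def)

lemma totally_isotropic_insert:
  assumes A: "totally_isotropic \<phi> A" and w: "w \<in> gr j" "form \<phi> w w = 0"
    and Aw: "\<And>a. a \<in> A \<Longrightarrow> form \<phi> a w = 0" "\<And>a. a \<in> A \<Longrightarrow> form \<phi> w a = 0"
  shows "totally_isotropic \<phi> (span (insert w A))"
  unfolding totally_isotropic_def
proof (intro conjI ballI)
  have gA: "graded_subspace A"
    using A by (simp add: totally_isotropic_def)
  then show "graded_subspace (span (insert w A))"
    using w(1) by (rule graded_subspace_insert)
  fix x y assume "x \<in> span (insert w A)" "y \<in> span (insert w A)"
  then obtain s t where xy: "x - scale s w \<in> A" "y - scale t w \<in> A"
    using mem_span_insert_subspace[OF graded_subspaceD(1)[OF gA]] by blast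
  define a where "a = x - scale s w"
  define b where "b = y - scale t w"
  have "x = a + scale s w" "y = b + scale t w" "a \<in> A" "b \<in> A"
    using xy by (simp_all add: a_def b_def)
  moreover from this have "form \<phi> a b = 0"
    using A by (simp add: totally_isotropic_def)
  ultimately show "form \<phi> x y = 0"
    using w(2) Aw by (simp add: form_simps)
qed

lemma totally_isotropic_sums:
  assumes "totally_isotropic \<phi> A" "totally_isotropic \<phi> B"
    and "\<And>a b. a \<in> A \<Longrightarrow> b \<in> B \<Longrightarrow> form \<phi> a b = 0"
  shows "totally_isotropic \<phi> {a + b | a b. a \<in> A \<and> b \<in> B}"
proof -
  have gr: "graded_subspace A" "graded_subspace B"
    using assms by (simp_all add: totally_isotropic_def)
  have "form \<phi> b a = 0" if "a \<in> A" "b \<in> B" for a b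
    using form_swap_zero[OF gr] assms(3) that by blast
  then show ?thesis
    using assms graded_subspace_sums[OF gr]
    by (auto simp: totally_isotropic_def form_simps)
qed

end

definition maximal_isotropic_ideal :: "('v \<Rightarrow> 'k) \<Rightarrow> 'v set \<Rightarrow> 'v set \<Rightarrow> bool" where
  "maximal_isotropic_ideal \<phi> L A \<longleftrightarrow> ideal_of L A \<and> totally_isotropic \<phi> A \<and>
     (\<forall>B. ideal_of L B \<and> totally_isotropic \<phi> B \<and> A \<subseteq> B \<longrightarrow> B = A)"

lemma maximal_isotropic_idealD:
  assumes "maximal_isotropic_ideal \<phi> L A"
  shows "ideal_of L A" "totally_isotropic \<phi> A"
    and "\<And>B. ideal_of L B \<Longrightarrow> totally_isotropic \<phi> B \<Longrightarrow> A \<subseteq> B \<Longrightarrow> B = A"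
  using assms by (auto simp: maximal_isotropic_ideal_def)

lemma ex_maximal_isotropic_ideal:
  assumes \<phi>: "\<phi> \<in> functionals" and L: "subspace L"
  obtains A where "maximal_isotropic_ideal \<phi> L A"
proof -
  have "even_part 0 = 0"
    by (simp add: even_part_of_even subspace_0 subspace_gr)
  then have "ideal_of L {0}" "totally_isotropic \<phi> {0}"
    using subspace_0[OF L]
    by (simp_all add: ideal_of_def totally_isotropic_def graded_subspace_iff_even_part
        form_simps[OF \<phi>])
  then show ?thesis
    using ex_maximal_subspace[of "\<lambda>A. ideal_of L A \<and> totally_isotropic \<phi> A" "{0}"] that
    by (metis ideal_ofD(2) maximal_isotropic_ideal_def)
qed

end

section \<open>Chief factors\<close>

text \<open>
  The factor \<open>B/A\<close> is an irreducible graded \<open>L\<close>-module. It is handled through \<open>A\<close> and \<open>B\<close>: a statement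
  about \<open>B/A\<close> is a statement about elements of \<open>B\<close> modulo \<open>A\<close>.
\<close>

locale chief_factor = super_lie_algebra scale gr bracket
  for scale :: "'k::{alg_closed_field,field_char_0} \<Rightarrow> 'v::ab_group_add \<Rightarrow> 'v"
    and gr bracket +
  fixes L A B :: "'v set"
  assumes subalgebra: "graded_subalgebra L"
    and ideal_A: "ideal_of L A" and ideal_B: "ideal_of L B"
    and A_sub_B: "A \<subset> B"
    and minimal: "\<And>C. ideal_of L C \<Longrightarrow> A \<subset> C \<Longrightarrow> C \<subseteq> B \<Longrightarrow> C = B"
begin

lemmas ideal_facts = ideal_ofD[OF ideal_A] ideal_ofD[OF ideal_B]

lemma graded_L: "graded_subspace L"
  using subalgebra by (simp add: graded_subalgebra_def)

lemma bracket_L: "x \<in> L \<Longrightarrow> y \<in> L \<Longrightarrow> bracket x y \<in> L"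
  using subalgebra by (simp add: graded_subalgebra_def)

lemma bracket_A_right: "x \<in> A \<Longrightarrow> y \<in> L \<Longrightarrow> bracket x y \<in> A"
  by (rule ideal_of_bracket_right[OF graded_L ideal_A])

text \<open>
  A chief factor of a solvable algebra is abelian. Intersect \<open>B\<close> with the terms of the derived series,
  and let \<open>D\<close> be the last of these intersections not inside \<open>A\<close>. Irreducibility gives \<open>B = A + D\<close>,
  and \<open>[D, D]\<close> is inside \<open>A\<close> by the choice of \<open>D\<close>.
\<close>

lemma bracket_B_B_mem_A:
  assumes solvable and "x \<in> B" "y \<in> B"
  shows "bracket x y \<in> A"
proof -
  have B_L: "B \<subseteq> L" by (rule ideal_facts)
  obtain n where n: "\<not> derived n \<inter> B \<subseteq> A" "derived (Suc n) \<inter> B \<subseteq> A"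
    using last_derived_not_subset[OF assms(1), of A B] ideal_facts(2) A_sub_B by blast
  define D where "D = derived n \<inter> B"
  have D: "ideal_of L D"
    using ideal_of_Int[OF ideal_of_derived_Int[OF subalgebra, of n] ideal_B] B_L
    by (simp add: D_def Int_assoc Int_absorb1)
  let ?C = "{a + d | a d. a \<in> A \<and> d \<in> D}"
  have "ideal_of L ?C"
    using graded_L by (intro ideal_of_sums ideal_A D) (rule graded_subspaceD)
  moreover have "A \<subset> ?C"
  proof
    show "A \<subseteq> ?C"
      using subspace_0[OF ideal_ofD(2)[OF D]] by force
    obtain d where "d \<in> D" "d \<notin> A"
      using n(1) by (auto simp: D_def)
    moreover from this have "d \<in> ?C"
      using subspace_0[OF ideal_facts(2)] by force
    ultimately show "A \<noteq> ?C" by blast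
  qed
  moreover have "?C \<subseteq> B"
    using A_sub_B ideal_facts(6) by (auto simp: D_def intro: subspace_add)
  ultimately have "?C = B" by (rule minimal)
  then obtain a d a' d' where xy: "x = a + d" "y = a' + d'"
    and mem: "a \<in> A" "d \<in> D" "a' \<in> A" "d' \<in> D"
    using assms(2,3) by blast
  have in_L: "a \<in> L" "d \<in> L" "a' \<in> L" "d' \<in> L"
    using mem ideal_facts(3) ideal_ofD(3)[OF D] by auto
  have "bracket d d' \<in> derived (Suc n) \<inter> B"
    using mem ideal_facts(8) in_L bracket_mem_derived_Suc by (auto simp: D_def)
  then have "bracket d d' \<in> A"
    using n(2) by blast
  moreover have "bracket a a' \<in> A" "bracket a d' \<in> A" "bracket d a' \<in> A"
    using mem in_L bracket_A_right ideal_facts(4) by auto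
  ultimately show ?thesis
    using ideal_facts(2) by (simp add: xy bracket_add_left bracket_add_right subspace_add)
qed

definition centralizer :: "'v set" where
  "centralizer = {x \<in> L. \<forall>v\<in>B. bracket x v \<in> A}"

lemma subspace_centralizer: "subspace centralizer"
  using graded_subspaceD(1)[OF graded_L] ideal_facts(2)
  by (auto simp: centralizer_def bracket_add_left bracket_scale_left subspace_0 subspace_add
      subspace_scale intro!: subspaceI)

lemma centralizerD: "x \<in> centralizer \<Longrightarrow> v \<in> B \<Longrightarrow> bracket x v \<in> A"
  by (simp add: centralizer_def)

text \<open>
  With \<open>S = x - \<mu>\<close> for an eigenvalue \<open>\<mu>\<close> of \<open>x\<close> on \<open>B/A\<close>, the generalized eigenspace \<open>W\<close> is an
  ideal: bracketing with \<open>y\<close> commutes with \<open>S\<close> up to \<open>[x, y]\<close>, which lies in \<open>I\<close> and commutes with \<open>x\<close> on the factor.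
  So \<open>W = B\<close> and \<open>S\<close> is nilpotent on \<open>B/A\<close>. If \<open>w\<close> is an eigenvector, skewness of \<open>x\<close> gives
  \<open>\<langle>w, S u\<rangle> = -2\<mu> \<langle>w, u\<rangle>\<close>; iterating until \<open>S\<^sup>m u\<close> falls into \<open>A\<close> shows that \<open>w\<close> is orthogonal to all of
  \<open>B\<close> unless \<open>\<mu> = 0\<close>.
\<close>

lemma even_nilpotent_on_factor:
  assumes I: "ideal_of L I" and abelian: "\<And>x y. x \<in> I \<Longrightarrow> y \<in> I \<Longrightarrow> bracket x y \<in> centralizer"
    and \<phi>: "\<phi> \<in> functionals"
    and radical: "\<And>a y. a \<in> A \<Longrightarrow> y \<in> L \<Longrightarrow> form \<phi> a y = 0"
    and nondegenerate: "\<And>u. u \<in> B \<Longrightarrow> (\<And>v. v \<in> B \<Longrightarrow> form \<phi> u v = 0) \<Longrightarrow> u \<in> A"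
    and BB: "\<And>u v. u \<in> B \<Longrightarrow> v \<in> B \<Longrightarrow> bracket u v \<in> A"
    and x: "x \<in> I" "x \<in> gr 0" and v: "v \<in> B"
  shows "\<exists>m. (bracket x ^^ m) v \<in> A"
proof -
  have xL: "x \<in> L" using x(1) ideal_ofD[OF I] by auto
  have sA: "subspace A" and sB: "subspace B" and B_L: "B \<subseteq> L" and A_B: "A \<subseteq> B"
    using ideal_facts A_sub_B by auto
  obtain Basis where Basis: "finite_dimensional_vector_space scale Basis"
    by (rule obtain_finite_basis)
  have "bracket x ` B \<subseteq> B" "\<not> B \<subseteq> A"
    using ideal_facts(8) xL A_sub_B by auto
  with Basis bracket_linear_right sA sB obtain \<mu> w
    where w: "w \<in> B" "w \<notin> A" "bracket x w - scale \<mu> w \<in> A"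
    by (rule ex_eigenvector_modulo)
  define S where "S = (\<lambda>u. bracket x u - scale \<mu> u)"
  have S_add: "S (u + u') = S u + S u'" and S_scale: "S (scale c u) = scale c (S u)" for u u' c
    by (simp_all add: S_def bracket_add_right bracket_scale_right scale_right_distrib
        scale_right_diff_distrib scale_left_commute)
  have Sm_add: "(S ^^ m) (u + u') = (S ^^ m) u + (S ^^ m) u'"
    and Sm_scale: "(S ^^ m) (scale c u) = scale c ((S ^^ m) u)" for m u u' c
    by (induction m) (simp_all add: S_add S_scale)
  have S_A: "S u \<in> A" if "u \<in> A" for u
    using that ideal_facts(4)[OF xL] sA by (simp add: S_def subspace_diff subspace_scale)
  have S_B: "S u \<in> B" if "u \<in> B" for u
    using that ideal_facts(8)[OF xL] sB by (simp add: S_def subspace_diff subspace_scale)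
  have Sm_A: "(S ^^ m) u \<in> A" if "u \<in> A" for m u
    using that by (induction m) (simp_all add: S_A)
  have Sm_mono: "(S ^^ n) u \<in> A" if "(S ^^ m) u \<in> A" "m \<le> n" for m n u
    using Sm_A[OF that(1), of "n - m"] that(2) funpow_add[of "n - m" m S] by simp
  have S_bracket: "S (bracket y u) = bracket (bracket x y) u + bracket y (S u)" for y u
    using bracket_even_derivation[OF x(2), of y u]
    by (simp add: S_def bracket_diff_right bracket_scale_right)
  \<comment> \<open>elements of \<open>I\<close> commute with \<open>x\<close> on \<open>B/A\<close>, so they preserve the kernel of each power of \<open>S\<close> there\<close>
  have I_step: "(S ^^ m) (bracket y u) \<in> A" if "y \<in> I" "u \<in> B" "(S ^^ m) u \<in> A" for m y u
    using that
  proof (induction m arbitrary: u)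
    case 0
    then show ?case using ideal_facts(4) ideal_ofD(3)[OF I] by auto
  next
    case (Suc m)
    have "bracket (bracket x y) u \<in> A"
      using centralizerD abelian x(1) Suc.prems by blast
    moreover have "(S ^^ m) (bracket y (S u)) \<in> A"
      using Suc.IH[of "S u"] Suc.prems S_B by (simp add: funpow_swap1)
    ultimately have "(S ^^ m) (S (bracket y u)) \<in> A"
      by (simp add: S_bracket Sm_add Sm_A subspace_add[OF sA])
    then show ?case by (simp add: funpow_swap1)
  qed
  \<comment> \<open>an arbitrary \<open>y\<close> satisfies \<open>[[x, y], x] = 0\<close> on \<open>B/A\<close>, which at most doubles the exponent\<close>
  have L_step: "(S ^^ (2 * m)) (bracket y u) \<in> A" if "y \<in> L" "u \<in> B" "(S ^^ m) u \<in> A" for m y u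
    using that
  proof (induction m arbitrary: u)
    case 0
    then show ?case using ideal_facts(4) by simp
  next
    case (Suc m)
    have "bracket x y \<in> I"
      using ideal_of_bracket_right[OF graded_L I x(1)] Suc.prems(1) by simp
    then have "(S ^^ Suc m) (bracket (bracket x y) u) \<in> A"
      using Suc.prems by (intro I_step)
    then have "(S ^^ Suc (2 * m)) (bracket (bracket x y) u) \<in> A"
      by (rule Sm_mono) simp
    moreover have "(S ^^ (2 * m)) (bracket y (S u)) \<in> A"
      using Suc.IH[of "S u"] Suc.prems S_B by (simp add: funpow_swap1)
    then have "(S ^^ Suc (2 * m)) (bracket y (S u)) \<in> A"
      by (rule Sm_mono) simp
    ultimately have "(S ^^ Suc (2 * m)) (S (bracket y u)) \<in> A"
      by (simp only: S_bracket Sm_add subspace_add[OF sA])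
    then have "(S ^^ Suc (Suc (2 * m))) (bracket y u) \<in> A"
      by (simp only: funpow_Suc_right o_apply)
    then show ?case by simp
  qed
  define W where "W = {u \<in> B. \<exists>m. (S ^^ m) u \<in> A}"
  have "ideal_of L W"
    unfolding ideal_of_def graded_subspace_iff_even_part
  proof (intro conjI ballI)
    show "subspace W"
    proof (rule subspaceI)
      show "0 \<in> W"
        using subspace_0[OF sB] subspace_0[OF sA] by (auto simp: W_def intro!: exI[of _ 0])
      fix u u' assume "u \<in> W" "u' \<in> W"
      then obtain m m' where u: "u \<in> B" "u' \<in> B" "(S ^^ m) u \<in> A" "(S ^^ m') u' \<in> A"
        by (auto simp: W_def)
      then have "(S ^^ max m m') (u + u') \<in> A"
        using Sm_mono[of m u "max m m'"] Sm_mono[of m' u' "max m m'"]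
        by (simp add: Sm_add subspace_add[OF sA])
      then show "u + u' \<in> W"
        using u subspace_add[OF sB] by (auto simp: W_def)
    next
      fix c u assume "u \<in> W"
      then show "scale c u \<in> W"
        using sA sB by (auto simp: W_def Sm_scale intro: subspace_scale)
    qed
    have "even_part (S u) = S (even_part u)" for u
      using x(2) by (simp add: S_def even_part_diff even_part_scale even_part_bracket even_part_of_even)
    then have "even_part ((S ^^ m) u) = (S ^^ m) (even_part u)" for m u
      by (induction m) simp_all
    then show "even_part u \<in> W" if "u \<in> W" for u
      using that graded_subspaceD(2)[OF ideal_facts(1)] graded_subspaceD(2)[OF ideal_facts(5)]
      unfolding W_def mem_Collect_eq by metis
    show "bracket y u \<in> W" if "y \<in> L" "u \<in> W" for y u
      using that L_step ideal_facts(8) by (auto simp: W_def)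
    show "W \<subseteq> L"
      using B_L by (auto simp: W_def)
  qed
  moreover have "A \<subset> W"
  proof
    show "A \<subseteq> W"
      using A_B by (auto simp: W_def intro: exI[of _ 0])
    have "w \<in> W"
      using w by (auto simp: W_def S_def intro!: exI[of _ 1])
    with w(2) show "A \<noteq> W" by auto
  qed
  ultimately have "W = B"
    by (rule minimal) (auto simp: W_def)
  have radical': "form \<phi> y a = 0" if "a \<in> A" "y \<in> L" for a y
    using form_swap_zero[OF \<phi> ideal_facts(1) graded_L radical] that by blast
  have "\<mu> = 0"
  proof (rule ccontr)
    assume "\<mu> \<noteq> 0"
    have step: "form \<phi> w (S u) = - 2 * \<mu> * form \<phi> w u" if u: "u \<in> B" for u
    proof -
      have "form \<phi> x (bracket w u) = 0"
        using BB w(1) u xL radical' by blast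
      then have "form \<phi> (bracket x w) u + form \<phi> w (bracket x u) = 0"
        unfolding form_def bracket_even_derivation[OF x(2)] by (simp add: functional_simps[OF \<phi>])
      moreover have "form \<phi> (bracket x w) u = \<mu> * form \<phi> w u"
        using radical[OF w(3), of u] u B_L by (auto simp: form_simps[OF \<phi>])
      ultimately have "form \<phi> w (bracket x u) = - (\<mu> * form \<phi> w u)"
        by (simp add: add_eq_0_iff)
      then show ?thesis
        by (simp add: S_def form_simps[OF \<phi>])
    qed
    have Sm_B: "(S ^^ m) u \<in> B" if "u \<in> B" for m u
      using that by (induction m) (simp_all add: S_B)
    have iter: "form \<phi> w ((S ^^ m) u) = (- 2 * \<mu>) ^ m * form \<phi> w u" if u: "u \<in> B" for m u
      using step[OF Sm_B[OF u]] by (induction m) simp_all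
    have "form \<phi> w u = 0" if u: "u \<in> B" for u
    proof -
      obtain m where "(S ^^ m) u \<in> A"
        using u \<open>W = B\<close> by (auto simp: W_def)
      then have "form \<phi> w ((S ^^ m) u) = 0"
        using radical' w(1) B_L by blast
      then show ?thesis
        using iter[OF u, of m] \<open>\<mu> \<noteq> 0\<close> by simp
    qed
    then have "w \<in> A"
      using w(1) nondegenerate by blast
    with w(2) show False ..
  qed
  then have "S = bracket x"
    by (simp add: S_def fun_eq_iff)
  then show ?thesis
    using v \<open>W = B\<close> by (auto simp: W_def)
qed

text \<open>
  For odd \<open>x\<close> the Jacobi identity reads \<open>2 x\<^sup>2 = [x, x]\<close> as operators, so an odd element of an
  abelian ideal acts with square zero.
\<close>

lemma odd_square_zero_on_factor:
  assumes "bracket x x \<in> centralizer" "x \<in> gr 1" "v \<in> B"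
  shows "bracket x (bracket x v) \<in> A"
proof -
  have "bracket x (bracket x v) + bracket x (bracket x v) = bracket (bracket x x) v"
    by (subst jacobi[OF assms(2,2)]) (simp add: koszul_def)
  then have "scale 2 (bracket x (bracket x v)) \<in> A"
    using centralizerD[OF assms(1,3)] scale_left_distrib[of 1 1 "bracket x (bracket x v)"] by simp
  then have "scale (1 / 2) (scale 2 (bracket x (bracket x v))) \<in> A"
    by (rule subspace_scale[OF ideal_facts(2)])
  then show ?thesis by simp
qed

text \<open>
  As in Engel's theorem for commuting operators: add one operator \<open>x\<close> at a time, replacing a null vector
  \<open>v\<close> of the previous ones by the last nonzero vector among the \<open>x\<^sup>n v\<close>. Supercommutation keeps these
  vectors null for the previous operators.
\<close>

lemma common_null_vector:
  assumes F: "finite F" "F \<subseteq> L" "\<And>x. x \<in> F \<Longrightarrow> \<exists>i. x \<in> gr i"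
    and comm: "\<And>x y. x \<in> F \<Longrightarrow> y \<in> F \<Longrightarrow> bracket x y \<in> centralizer"
    and nil: "\<And>x v. x \<in> F \<Longrightarrow> v \<in> B \<Longrightarrow> \<exists>m. (bracket x ^^ m) v \<in> A"
  shows "\<exists>v\<in>B. v \<notin> A \<and> (\<forall>x\<in>F. bracket x v \<in> A)"
  using assms
proof (induction F)
  case empty
  then show ?case using A_sub_B by auto
next
  case (insert x F)
  have "\<exists>v\<in>B. v \<notin> A \<and> (\<forall>y\<in>F. bracket y v \<in> A)"
  proof (rule insert.IH)
    show "F \<subseteq> L" using insert.prems(1) by simp
    show "\<exists>i. y \<in> gr i" if "y \<in> F" for y
      by (rule insert.prems(2)) (simp add: that)
    show "bracket y z \<in> centralizer" if "y \<in> F" "z \<in> F" for y z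
      by (rule insert.prems(3)) (simp_all add: that)
    show "\<exists>m. (bracket y ^^ m) u \<in> A" if "y \<in> F" "u \<in> B" for y u
      by (rule insert.prems(4)) (simp_all add: that)
  qed
  then obtain v where v: "v \<in> B" "v \<notin> A" "\<And>y. y \<in> F \<Longrightarrow> bracket y v \<in> A"
    by blast
  have x: "x \<in> L" using insert.prems by simp
  obtain i where i: "x \<in> gr i" using insert.prems(2)[of x] by auto
  define m where "m = (LEAST m. (bracket x ^^ m) v \<in> A)"
  have m: "(bracket x ^^ m) v \<in> A"
    unfolding m_def by (rule LeastI_ex) (use insert.prems(4)[of x v] v(1) in simp)
  with v(2) obtain k where k: "m = Suc k" by (cases m) auto
  then have least: "(bracket x ^^ k) v \<notin> A"
    using not_less_Least[of k "\<lambda>m. (bracket x ^^ m) v \<in> A"] by (simp add: m_def)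
  have in_B: "(bracket x ^^ n) v \<in> B" for n
    using v(1) x ideal_facts(8) by (induction n) auto
  have null: "bracket y ((bracket x ^^ n) v) \<in> A" if y: "y \<in> F" for y n
  proof (induction n)
    case 0
    then show ?case using v(3)[OF y] by simp
  next
    case (Suc n)
    let ?u = "(bracket x ^^ n) v"
    obtain j where j: "y \<in> gr j" using insert.prems(2)[of y] y by auto
    have "bracket (bracket y x) ?u \<in> A"
      using insert.prems(3)[of y x] y in_B by (intro centralizerD) simp_all
    moreover have "bracket x (bracket y ?u) \<in> A"
      using Suc.IH x ideal_facts(4) by blast
    ultimately have "bracket y (bracket x ?u) \<in> A"
      unfolding jacobi[OF j i] using ideal_facts(2) by (intro subspace_add subspace_scale)
    then show ?case by simp
  qed
  moreover have "bracket x ((bracket x ^^ k) v) \<in> A"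
    using m k by simp
  ultimately show ?case
    using in_B least by blast
qed

text \<open>
  The null vectors of \<open>I\<close> in \<open>B/A\<close> form a submodule, as \<open>I\<close> is an ideal, and a nonzero one
  by the previous lemma. By irreducibility it is everything.
\<close>

lemma subset_centralizer:
  assumes I: "ideal_of L I" and abelian: "\<And>x y. x \<in> I \<Longrightarrow> y \<in> I \<Longrightarrow> bracket x y \<in> centralizer"
    and nil: "\<And>x v. x \<in> I \<Longrightarrow> x \<in> gr 0 \<Longrightarrow> v \<in> B \<Longrightarrow> \<exists>m. (bracket x ^^ m) v \<in> A"
  shows "I \<subseteq> centralizer"
proof -
  note I' = ideal_ofD[OF I]
  obtain F where F: "finite F" "F \<subseteq> I" "\<And>x. x \<in> F \<Longrightarrow> \<exists>i. x \<in> gr i" "I \<subseteq> span F"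
    using finite_homogeneous_spanning_set[OF I'(1)] by blast
  have nilF: "\<exists>m. (bracket x ^^ m) v \<in> A" if x: "x \<in> F" and v: "v \<in> B" for x v
  proof -
    obtain i where i: "x \<in> gr i" using F(3) x by blast
    have xI: "x \<in> I" using x F(2) by blast
    show ?thesis
    proof (cases "i = 0")
      case True
      then show ?thesis using nil[OF xI _ v] i by simp
    next
      case False
      then have "bracket x (bracket x v) \<in> A"
        using odd_square_zero_on_factor[OF abelian[OF xI xI] _ v] i by simp
      then show ?thesis
        by (intro exI[of _ 2]) (simp add: numeral_2_eq_2)
    qed
  qed
  obtain v where v: "v \<in> B" "v \<notin> A" "\<And>x. x \<in> F \<Longrightarrow> bracket x v \<in> A"
    using common_null_vector[OF F(1) subset_trans[OF F(2) I'(3)] F(3) abelian[OF subsetD subsetD, OF F(2) _ F(2)] nilF]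
    by blast
  define K where "K = {v \<in> B. \<forall>x\<in>I. bracket x v \<in> A}"
  have "span F \<subseteq> {x. bracket x v \<in> A}"
    using v(3) ideal_facts(2)
    by (intro span_minimal)
      (auto simp: bracket_add_left bracket_scale_left subspace_0 subspace_add subspace_scale
        intro!: subspaceI)
  then have "v \<in> K"
    using v(1) F(4) by (auto simp: K_def)
  moreover have "A \<subseteq> K"
    using A_sub_B ideal_facts(4) I'(3) by (auto simp: K_def)
  moreover have "ideal_of L K"
    unfolding ideal_of_def
  proof (intro conjI ballI)
    show "graded_subspace K"
      unfolding K_def by (intro graded_subspace_transporter I' ideal_facts)
    show "K \<subseteq> L"
      using ideal_facts(7) by (auto simp: K_def)
    fix y u assume y: "y \<in> L" and u: "u \<in> K"
    have "bracket x (bracket y u) \<in> A" if "x \<in> I" for x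
    proof (rule nested_bracket_right_mem[OF I'(1) graded_L ideal_facts(2) _ _ that y])
      fix x y assume "x \<in> I" "y \<in> L"
      then show "bracket (bracket x y) u \<in> A" "bracket y (bracket x u) \<in> A"
        using u ideal_of_bracket_right[OF graded_L I] ideal_facts(4) by (auto simp: K_def)
    qed
    then show "bracket y u \<in> K"
      using y u ideal_facts(8) by (auto simp: K_def)
  qed
  ultimately have "K = B"
    using v(2) by (intro minimal) (auto simp: K_def)
  then show ?thesis
    using I'(3) by (auto simp: K_def centralizer_def)
qed

text \<open>
  Otherwise the last term of the derived series not centralizing the factor would be an ideal with
  abelian nonzero image in \<open>gl(B/A)\<close>, and \<open>even_nilpotent_on_factor\<close> with \<open>subset_centralizer\<close> excludes
  this.
\<close>

lemma factor_central:
  assumes solvable and \<phi>: "\<phi> \<in> functionals"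
    and radical: "\<And>a y. a \<in> A \<Longrightarrow> y \<in> L \<Longrightarrow> form \<phi> a y = 0"
    and nondegenerate: "\<And>u. u \<in> B \<Longrightarrow> (\<And>v. v \<in> B \<Longrightarrow> form \<phi> u v = 0) \<Longrightarrow> u \<in> A"
    and "x \<in> L" "v \<in> B"
  shows "bracket x v \<in> A"
proof -
  have "L \<subseteq> centralizer"
  proof (rule ccontr)
    assume "\<not> L \<subseteq> centralizer"
    then obtain n where n: "\<not> derived n \<inter> L \<subseteq> centralizer" "derived (Suc n) \<inter> L \<subseteq> centralizer"
      using last_derived_not_subset[OF assms(1) subspace_centralizer] by blast
    define I where "I = derived n \<inter> L"
    have I: "ideal_of L I"
      unfolding I_def by (rule ideal_of_derived_Int[OF subalgebra])
    have abelian: "bracket x y \<in> centralizer" if "x \<in> I" "y \<in> I" for x y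
      using that n(2) bracket_mem_derived_Suc bracket_L by (auto simp: I_def)
    have "I \<subseteq> centralizer"
      using even_nilpotent_on_factor[OF I abelian \<phi> radical nondegenerate]
        bracket_B_B_mem_A[OF assms(1)]
      by (intro subset_centralizer I abelian) blast+
    with n(1) show False by (simp add: I_def)
  qed
  then show ?thesis
    using assms(5,6) centralizerD by blast
qed

end

section \<open>Polarizations\<close>

locale solvable_super_lie_functional = super_lie_algebra scale gr bracket
  for scale :: "'k::{alg_closed_field,field_char_0} \<Rightarrow> 'v::ab_group_add \<Rightarrow> 'v"
    and gr bracket +
  fixes \<phi> :: "'v \<Rightarrow> 'k"
  assumes solvable: solvable and functional: "\<phi> \<in> functionals"
begin

lemmas form_rules = form_simps[OF functional]

lemma form_even_self:
  assumes "x \<in> gr 0"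
  shows "form \<phi> x x = 0"
proof -
  have "form \<phi> x x = - form \<phi> x x"
    using bracket_antisym[OF assms assms] functional_simps(3)[OF functional, of "- 1" "bracket x x"]
    by (simp add: form_def koszul_def)
  then show ?thesis by simp
qed

text \<open>
  With \<open>A\<close> in the radical, adjoining to it an isotropic homogeneous vector that is central modulo
  \<open>A\<close> gives an isotropic ideal again, so by maximality the vector was already in \<open>A\<close>.
\<close>

lemma mem_maximal_isotropic_ideal:
  assumes L: "graded_subspace L" and A: "maximal_isotropic_ideal \<phi> L A"
    and radical: "\<And>a y. a \<in> A \<Longrightarrow> y \<in> L \<Longrightarrow> form \<phi> a y = 0"
    and w: "w \<in> L" "w \<in> gr j" "\<And>x. x \<in> L \<Longrightarrow> bracket x w \<in> A" "form \<phi> w w = 0"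
  shows "w \<in> A"
proof -
  note A' = maximal_isotropic_idealD[OF A]
  have "form \<phi> w a = 0" if "a \<in> A" for a
    using form_swap_zero[OF functional ideal_ofD(1)[OF A'(1)] L radical w(1) that] .
  then have "totally_isotropic \<phi> (span (insert w A))"
    using A'(2) w radical by (intro totally_isotropic_insert[OF functional]) auto
  moreover have "ideal_of L (span (insert w A))"
    using A'(1) w graded_subspaceD(1)[OF L] by (intro ideal_of_insert) auto
  ultimately have "span (insert w A) = A"
    by (intro A'(3)) (auto intro: span_base)
  then show ?thesis
    using span_base[of w "insert w A"] by auto
qed

text \<open>
  Take a chief factor \<open>B/A\<close>. The radical \<open>R\<close> of the form on \<open>B\<close> is an isotropic ideal, so \<open>R = A\<close>, the
  form on \<open>B/A\<close> is nondegenerate and \<open>factor_central\<close> applies. Even vectors of \<open>B\<close> are isotropic by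
  antisymmetry, and so belong to \<open>A\<close>; whatever is left in \<open>B\<close> is odd.
\<close>

lemma ex_odd_central_modulo_radical_ideal:
  assumes L: "graded_subalgebra L" and A: "maximal_isotropic_ideal \<phi> L A"
    and radical: "\<And>a y. a \<in> A \<Longrightarrow> y \<in> L \<Longrightarrow> form \<phi> a y = 0"
    and "A \<noteq> L"
  obtains \<theta> where "\<theta> \<in> L" "\<theta> \<in> gr 1" "\<theta> \<notin> A" "\<And>x. x \<in> L \<Longrightarrow> bracket x \<theta> \<in> A"
proof -
  note A' = maximal_isotropic_idealD[OF A]
  have gL: "graded_subspace L" using L by (simp add: graded_subalgebra_def)
  have "ideal_of L L \<and> A \<subset> L"
    using L assms(4) ideal_ofD(3)[OF A'(1)] by (auto simp: ideal_of_def graded_subalgebra_def)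
  then obtain B where B: "ideal_of L B \<and> A \<subset> B"
    and minimal: "\<And>C. ideal_of L C \<and> A \<subset> C \<Longrightarrow> C \<subseteq> B \<Longrightarrow> C = B"
    using ex_minimal_subspace[of "\<lambda>C. ideal_of L C \<and> A \<subset> C" L] ideal_ofD(2) by blast
  interpret chief_factor scale gr bracket L A B
    using L A'(1) B minimal by unfold_locales auto
  have gB: "graded_subspace B" and B_L: "B \<subseteq> L" using ideal_facts by auto
  define R where "R = B \<inter> orthogonal \<phi> B"
  have "graded_subspace R"
    using gB by (simp add: R_def graded_subspace_Int graded_subspace_orthogonal[OF functional])
  moreover have "totally_isotropic \<phi> R"
    using calculation by (auto simp: totally_isotropic_def R_def orthogonal_def)
  moreover have "bracket x u \<in> R" if x: "x \<in> L" and u: "u \<in> R" for x u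
  proof -
    have "form \<phi> (bracket x u) v = 0" if v: "v \<in> B" for v
    proof (rule form_bracket_left_zero[OF functional gL \<open>graded_subspace R\<close> _ _ x u])
      fix x u assume xu: "x \<in> L" "u \<in> R"
      have "bracket u v \<in> A"
        using bracket_B_B_mem_A[OF solvable] xu v by (auto simp: R_def)
      then show "form \<phi> x (bracket u v) = 0"
        using form_swap_zero[OF functional ideal_facts(1) gL radical] xu by blast
      show "form \<phi> u (bracket x v) = 0"
        using xu v ideal_facts(8) by (auto simp: R_def orthogonal_def)
    qed
    then show ?thesis
      using x u ideal_facts(8) by (auto simp: R_def orthogonal_def)
  qed
  ultimately have "R = A"
    using B_L A_sub_B radical by (intro A'(3)) (auto simp: ideal_of_def R_def orthogonal_def)
  then have nondegenerate: "u \<in> A" if "u \<in> B" "\<And>v. v \<in> B \<Longrightarrow> form \<phi> u v = 0" for u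
    using that by (auto simp: R_def orthogonal_def)
  have central: "bracket x v \<in> A" if "x \<in> L" "v \<in> B" for x v
    using factor_central[OF solvable functional radical nondegenerate that] .
  obtain v where v: "v \<in> B" "v \<notin> A" using A_sub_B by blast
  have "even_part v \<in> A"
  proof (rule mem_maximal_isotropic_ideal[OF gL A radical])
    have "even_part v \<in> B"
      using v(1) by (rule graded_subspaceD(2)[OF gB])
    then show "even_part v \<in> L" "\<And>x. x \<in> L \<Longrightarrow> bracket x (even_part v) \<in> A"
      using B_L central by auto
    show "even_part v \<in> gr 0" "form \<phi> (even_part v) (even_part v) = 0"
      by (simp_all add: even_part_even form_even_self)
  qed
  then have "v - even_part v \<notin> A"
    using v(2) subspace_add[OF ideal_facts(2), of "v - even_part v" "even_part v"] by auto
  then show ?thesis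
    using that[of "v - even_part v"] odd_part_odd graded_subspaceD(3)[OF gB v(1)] B_L central
    by auto
qed

text \<open>
  Polarizations of a subalgebra \<open>L\<close> at the restriction of \<open>\<phi>\<close>. That \<open>H\<close> contains the
  kernel of the restricted form is a consequence of maximality, by \<open>polarization_in_contains_radical\<close>.
\<close>

definition polarization_in :: "'v set \<Rightarrow> 'v set \<Rightarrow> bool" where
  "polarization_in L H \<longleftrightarrow> graded_subalgebra H \<and> H \<subseteq> L \<and> totally_isotropic \<phi> H \<and>
     (\<forall>W. totally_isotropic \<phi> W \<and> W \<subseteq> L \<and> H \<subseteq> W \<longrightarrow> W = H)"

text \<open>
  The sum of \<open>H\<close> and an isotropic subspace of the radical is isotropic, so it is \<open>H\<close> by maximality.
\<close>

lemma polarization_in_contains_radical: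
  assumes L: "graded_subspace L" and H: "polarization_in L H"
    and A: "totally_isotropic \<phi> A" "A \<subseteq> L" "\<And>a y. a \<in> A \<Longrightarrow> y \<in> L \<Longrightarrow> form \<phi> a y = 0"
  shows "A \<subseteq> H"
proof -
  have H': "totally_isotropic \<phi> H" "H \<subseteq> L"
    using H by (auto simp: polarization_in_def)
  let ?W = "{a + h | a h. a \<in> A \<and> h \<in> H}"
  have zero: "0 \<in> A" "0 \<in> H"
    using A(1) H'(1) by (auto simp: totally_isotropic_def graded_subspace_def subspace_0)
  have sum_mem: "a + h \<in> ?W" if "a \<in> A" "h \<in> H" for a h
    unfolding mem_Collect_eq by (rule exI[of _ a], rule exI[of _ h]) (simp add: that)
  have "h \<in> ?W" if "h \<in> H" for h
    using sum_mem[OF zero(1) that] unfolding add_0 .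
  then have "H \<subseteq> ?W" ..
  moreover have "?W \<subseteq> L"
    using A(2) H'(2) graded_subspaceD(1)[OF L] by (auto intro: subspace_add)
  moreover have "totally_isotropic \<phi> ?W"
    using A H' by (intro totally_isotropic_sums[OF functional]) auto
  ultimately have W_eq: "?W = H"
    using H by (simp only: polarization_in_def)
  show ?thesis
  proof
    fix a assume "a \<in> A"
    from sum_mem[OF this zero(2)] show "a \<in> H"
      unfolding W_eq add_0_right .
  qed
qed

text \<open>
  By the Jacobi identity \<open>\<langle>[x, y], a\<rangle>\<close> is a combination of \<open>\<langle>x, [y, a]\<rangle>\<close> and \<open>\<langle>y, [x, a]\<rangle>\<close>, where
  \<open>[y, a]\<close> and \<open>[x, a]\<close> belong to \<open>A\<close> again.
\<close>

lemma graded_subalgebra_orthogonal: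
  assumes L: "graded_subalgebra L" and A: "ideal_of L A"
  shows "graded_subalgebra (L \<inter> orthogonal \<phi> A)"
proof -
  note A' = ideal_ofD[OF A]
  let ?P = "L \<inter> orthogonal \<phi> A"
  have P: "graded_subspace ?P"
    using L A'(1)
    by (simp add: graded_subalgebra_def graded_subspace_Int graded_subspace_orthogonal[OF functional])
  have "form \<phi> (bracket x y) a = 0" if a: "a \<in> A" and "x \<in> ?P" "y \<in> ?P" for x y a
    by (rule form_bracket_left_zero[OF functional P P _ _ that(2,3)])
      (use a A'(4) in \<open>auto simp: orthogonal_def\<close>)
  then show ?thesis
    using L P by (auto simp: graded_subalgebra_def orthogonal_def)
qed

text \<open>
  Suppose \<open>A \<noteq> L\<close> and let \<open>\<theta>\<close> be odd and central modulo \<open>A\<close>, so that \<open>\<langle>\<theta>, \<theta>\<rangle> \<noteq> 0\<close>. Then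
  \<open>L = P \<oplus> k\<theta>\<close>, where \<open>P\<close> is the orthogonal of \<open>\<theta>\<close>. As \<open>\<theta>\<close> is central modulo \<open>A\<close>, ideals of \<open>P\<close>
  containing \<open>A\<close> are ideals of \<open>L\<close>, so \<open>A\<close> is still a maximal isotropic ideal of \<open>P\<close>. If \<open>A \<noteq> P\<close>, this yields a second
  odd vector \<open>\<eta>\<close>, orthogonal to \<open>\<theta>\<close> and central modulo \<open>A\<close>, and a suitable combination \<open>\<theta> + s\<eta>\<close> is
  isotropic and central modulo \<open>A\<close> but not in \<open>A\<close>. So \<open>A = P\<close>, and \<open>A\<close> is maximal isotropic because \<open>\<theta>\<close> is
  anisotropic.
\<close>

lemma polarization_in_radical_ideal:
  assumes L: "graded_subalgebra L" and A: "maximal_isotropic_ideal \<phi> L A"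
    and radical: "\<And>a y. a \<in> A \<Longrightarrow> y \<in> L \<Longrightarrow> form \<phi> a y = 0"
  shows "polarization_in L A"
proof -
  note A' = maximal_isotropic_idealD[OF A]
  note idA = ideal_ofD[OF A'(1)]
  have gL: "graded_subspace L" using L by (simp add: graded_subalgebra_def)
  note sL = graded_subspaceD(1)[OF gL]
  have subalgA: "graded_subalgebra A"
    using idA by (auto simp: graded_subalgebra_def)
  show ?thesis
  proof (cases "A = L")
    case True
    then show ?thesis
      using subalgA A'(2) by (auto simp: polarization_in_def)
  next
    case False
    obtain \<theta> where \<theta>: "\<theta> \<in> L" "\<theta> \<in> gr 1" "\<theta> \<notin> A" and central: "\<And>x. x \<in> L \<Longrightarrow> bracket x \<theta> \<in> A"
      using ex_odd_central_modulo_radical_ideal[OF L A radical False] by blast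
    have \<theta>\<theta>: "form \<phi> \<theta> \<theta> \<noteq> 0"
      using mem_maximal_isotropic_ideal[OF gL A radical \<theta>(1,2) central] \<theta>(3) by blast
    define \<Theta> where "\<Theta> = span (insert \<theta> A)"
    have \<Theta>: "ideal_of L \<Theta>"
      unfolding \<Theta>_def using sL A'(1) \<theta>(1,2) central by (rule ideal_of_insert)
    have mem_\<Theta>: "\<exists>t. y - scale t \<theta> \<in> A" if "y \<in> \<Theta>" for y
      using that mem_span_insert_subspace[OF idA(2)] by (simp add: \<Theta>_def)
    have \<theta>_\<Theta>: "\<theta> \<in> \<Theta>" by (simp add: \<Theta>_def span_base)
    have L_\<Theta>: "bracket x y \<in> A" if x: "x \<in> L" and "y \<in> \<Theta>" for x y
    proof -
      obtain t where "y - scale t \<theta> \<in> A" using mem_\<Theta> \<open>y \<in> \<Theta>\<close> by blast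
      then have "bracket x (y - scale t \<theta>) + scale t (bracket x \<theta>) \<in> A"
        using x idA(4) central by (intro subspace_add[OF idA(2)] subspace_scale[OF idA(2)]) auto
      then show ?thesis by (simp add: bracket_diff_right bracket_scale_right)
    qed
    have \<theta>_L: "bracket \<theta> x \<in> A" if "x \<in> L" for x
      using bracket_swap_mem[OF gL ideal_ofD(1)[OF \<Theta>] idA(2) L_\<Theta> \<theta>_\<Theta> that] .
    have radical': "form \<phi> y a = 0" if "a \<in> A" "y \<in> L" for a y
      using form_swap_zero[OF functional idA(1) gL radical] that by blast
    define P where "P = L \<inter> orthogonal \<phi> \<Theta>"
    have P: "graded_subalgebra P"
      unfolding P_def using L \<Theta> by (rule graded_subalgebra_orthogonal)
    then have gP: "graded_subspace P" by (simp add: graded_subalgebra_def)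
    have P_iff: "x \<in> P \<longleftrightarrow> x \<in> L \<and> form \<phi> x \<theta> = 0" for x
    proof
      assume x: "x \<in> L \<and> form \<phi> x \<theta> = 0"
      have "form \<phi> x y = 0" if y: "y \<in> \<Theta>" for y
      proof -
        obtain t where "y - scale t \<theta> \<in> A" using mem_\<Theta>[OF y] by blast
        then have "form \<phi> x (y - scale t \<theta>) = 0" using x radical' by blast
        then show ?thesis using x by (simp add: form_rules)
      qed
      with x show "x \<in> P" by (simp add: P_def orthogonal_def)
    qed (use \<theta>_\<Theta> in \<open>auto simp: P_def orthogonal_def\<close>)
    have split: "\<exists>t. x - scale t \<theta> \<in> P" if x: "x \<in> L" for x
      using x \<theta>(1) sL \<theta>\<theta>
      by (intro exI[of _ "form \<phi> x \<theta> / form \<phi> \<theta> \<theta>"])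
        (simp add: P_iff form_rules(3,5) subspace_diff subspace_scale)
    have A_P: "A \<subseteq> P"
      using idA(3) radical \<theta>(1) by (auto simp: P_iff)
    have maxP: "maximal_isotropic_ideal \<phi> P A"
      unfolding maximal_isotropic_ideal_def
    proof (intro conjI allI impI)
      show "ideal_of P A"
        using idA A_P by (auto simp: ideal_of_def P_iff)
      fix C assume C: "ideal_of P C \<and> totally_isotropic \<phi> C \<and> A \<subseteq> C"
      have "bracket x c \<in> C" if x: "x \<in> L" and c: "c \<in> C" for x c
      proof -
        obtain t where t: "x - scale t \<theta> \<in> P" using split x by blast
        have "c \<in> P" using C c ideal_ofD(3)[of P C] by blast
        then have "bracket \<theta> c \<in> C"
          using \<theta>_L C P_iff by blast
        moreover have "bracket (x - scale t \<theta>) c \<in> C" "subspace C"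
          using C c t ideal_ofD(2,4)[of P C] by blast+
        ultimately have "bracket (x - scale t \<theta>) c + scale t (bracket \<theta> c) \<in> C"
          by (simp add: subspace_add subspace_scale)
        then show ?thesis by (simp add: bracket_diff_left bracket_scale_left)
      qed
      then have "ideal_of L C"
        using C by (auto simp: ideal_of_def P_iff)
      then show "C = A" using C A'(3) by blast
    qed (rule A'(2))
    have "A = P"
    proof (rule ccontr)
      assume "A \<noteq> P"
      have radical_P: "form \<phi> a y = 0" if "a \<in> A" "y \<in> P" for a y
        using that radical by (simp add: P_iff)
      obtain \<eta> where \<eta>: "\<eta> \<in> P" "\<eta> \<in> gr 1" "\<eta> \<notin> A"
        and central_P: "\<And>x. x \<in> P \<Longrightarrow> bracket x \<eta> \<in> A"
        by (rule ex_odd_central_modulo_radical_ideal[OF P maxP radical_P \<open>A \<noteq> P\<close>]) (assumption | rule that)+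
      have \<eta>_L: "\<eta> \<in> L" using \<eta>(1) by (simp add: P_iff)
      have central_\<eta>: "bracket x \<eta> \<in> A" if x: "x \<in> L" for x
      proof -
        obtain t where "x - scale t \<theta> \<in> P" using split x by blast
        then have "bracket (x - scale t \<theta>) \<eta> + scale t (bracket \<theta> \<eta>) \<in> A"
          using central_P \<theta>_L[OF \<eta>_L]
          by (intro subspace_add[OF idA(2)] subspace_scale[OF idA(2)]) auto
        then show ?thesis by (simp add: bracket_diff_left bracket_scale_left)
      qed
      have \<eta>\<eta>: "form \<phi> \<eta> \<eta> \<noteq> 0"
        using mem_maximal_isotropic_ideal[OF gL A radical \<eta>_L \<eta>(2) central_\<eta>] \<eta>(3) by blast
      have \<eta>\<theta>: "form \<phi> \<eta> \<theta> = 0"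
        using \<eta>(1) by (simp add: P_iff)
      have \<theta>\<eta>: "form \<phi> \<theta> \<eta> = 0"
        by (rule form_swap_zero[OF functional gP ideal_ofD(1)[OF \<Theta>] _ \<theta>_\<Theta> \<eta>(1)])
          (auto simp: P_def orthogonal_def)
      obtain s where "s ^ 2 = - form \<phi> \<theta> \<theta> / form \<phi> \<eta> \<eta>"
        using nth_root_exists[of 2 "- form \<phi> \<theta> \<theta> / form \<phi> \<eta> \<eta>"] by auto
      then have s: "s * (s * form \<phi> \<eta> \<eta>) = - form \<phi> \<theta> \<theta>"
        using \<eta>\<eta> by (simp add: power2_eq_square mult.assoc[symmetric])
      define w where "w = \<theta> + scale s \<eta>"
      have "form \<phi> w w = 0"
        using s \<theta>\<eta> \<eta>\<theta> by (simp add: w_def form_rules)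
      moreover have "w \<in> L" "w \<in> gr 1"
        unfolding w_def using \<theta>(1,2) \<eta>(2) \<eta>_L sL subspace_gr
        by (simp_all add: subspace_add subspace_scale)
      moreover have "bracket x w \<in> A" if "x \<in> L" for x
        using central[OF that] central_\<eta>[OF that] idA(2)
        by (simp add: w_def bracket_add_right bracket_scale_right subspace_add subspace_scale)
      ultimately have "w \<in> A"
        by (intro mem_maximal_isotropic_ideal[OF gL A radical, of w 1])
      then have "form \<phi> w \<theta> = 0"
        using radical \<theta>(1) by blast
      with \<theta>\<theta> \<eta>\<theta> show False
        by (simp add: w_def form_rules)
    qed
    have "W = A" if W: "totally_isotropic \<phi> W" "W \<subseteq> L" "A \<subseteq> W" for W
    proof
      show "W \<subseteq> A"
      proof
        fix w assume w: "w \<in> W"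
        obtain t where t: "w - scale t \<theta> \<in> A"
          using split w W(2) \<open>A = P\<close> by blast
        have "subspace W"
          using W(1) by (simp add: totally_isotropic_def graded_subspace_def)
        then have "w - (w - scale t \<theta>) \<in> W"
          using w subsetD[OF W(3) t] by (rule subspace_diff)
        then have "scale t \<theta> \<in> W" by simp
        then have "form \<phi> (scale t \<theta>) (scale t \<theta>) = 0"
          using W(1) by (simp add: totally_isotropic_def)
        then have "t = 0"
          using \<theta>\<theta> by (simp add: form_rules)
        with t show "w \<in> A" by simp
      qed
    qed (rule W(3))
    then show ?thesis
      using subalgA A'(2) idA(3) by (auto simp: polarization_in_def)
  qed
qed

lemma ex_polarization_in:
  assumes "graded_subalgebra L"
  shows "\<exists>H. polarization_in L H"
  using assms
proof (induction "dim L" arbitrary: L rule: less_induct)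
  case less
  note L = \<open>graded_subalgebra L\<close>
  have gL: "graded_subspace L" using L by (simp add: graded_subalgebra_def)
  obtain A where A: "maximal_isotropic_ideal \<phi> L A"
    using ex_maximal_isotropic_ideal[OF functional graded_subspaceD(1)[OF gL]] by blast
  note A' = maximal_isotropic_idealD[OF A]
  note idA = ideal_ofD[OF A'(1)]
  define P where "P = L \<inter> orthogonal \<phi> A"
  have P: "graded_subalgebra P"
    unfolding P_def using L A'(1) by (rule graded_subalgebra_orthogonal)
  then have gP: "graded_subspace P" by (simp add: graded_subalgebra_def)
  have radical_P: "form \<phi> a y = 0" if "a \<in> A" "y \<in> P" for a y
    by (rule form_swap_zero[OF functional gP idA(1) _ that]) (auto simp: P_def orthogonal_def)
  show ?case
  proof (cases "P = L")
    case True
    then show ?thesis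
      using polarization_in_radical_ideal[OF L A] radical_P by blast
  next
    case False
    then have "dim P < dim L"
      using graded_subspaceD(1)[OF gP] graded_subspaceD(1)[OF gL]
      by (intro dim_less_if_psubset) (auto simp: P_def)
    then obtain H where H: "polarization_in P H"
      using less.hyps P by blast
    have "A \<subseteq> P"
      using A'(2) idA(3) by (auto simp: P_def orthogonal_def totally_isotropic_def)
    then have A_H: "A \<subseteq> H"
      using polarization_in_contains_radical[OF gP H A'(2)] radical_P by blast
    have "W \<subseteq> P" if "totally_isotropic \<phi> W" "W \<subseteq> L" "H \<subseteq> W" for W
      using that A_H by (auto simp: P_def orthogonal_def totally_isotropic_def)
    then have "polarization_in L H"
      using H by (auto simp: polarization_in_def P_def)
    then show ?thesis ..
  qed
qed

lemma polarization_if_polarization_in_UNIV: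
  assumes H: "polarization_in UNIV H"
  shows "polarization \<phi> H"
proof -
  have H': "graded_subalgebra H" "totally_isotropic \<phi> H"
    using H by (auto simp: polarization_in_def)
  have "commutator H H \<subseteq> {z. \<phi> z = 0}"
    unfolding commutator_def
    using H'(2) subspace_functional_kernel[OF functional]
    by (intro span_minimal) (auto simp: totally_isotropic_def form_def)
  moreover have "form_kernel \<phi> = orthogonal \<phi> UNIV"
    by (simp add: form_kernel_def orthogonal_def)
  then have "totally_isotropic \<phi> (form_kernel \<phi>)"
    using graded_subspace_orthogonal[OF functional graded_subspace_UNIV]
    by (simp add: totally_isotropic_def orthogonal_def)
  then have "form_kernel \<phi> \<subseteq> H"
    by (intro polarization_in_contains_radical[OF graded_subspace_UNIV H])
      (auto simp: form_kernel_def)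
  ultimately show ?thesis
    using H H' by (auto simp: polarization_def subordinate_def maximal_totally_isotropic_def
        polarization_in_def)
qed

end

theorem proposition3p6:
  fixes scale :: "'k::{alg_closed_field,field_char_0} \<Rightarrow> 'v::ab_group_add \<Rightarrow> 'v"
    and gr :: "bit \<Rightarrow> 'v set"
    and bracket :: "'v \<Rightarrow> 'v \<Rightarrow> 'v"
    and \<phi> :: "'v \<Rightarrow> 'k"
  assumes "super_lie_algebra scale gr bracket"
    and "super_lie_algebra.solvable scale bracket"
    and "\<phi> \<in> super_lie_algebra.functionals scale gr"
  shows "\<exists>H. super_lie_algebra.polarization scale gr bracket \<phi> H"
proof -
  interpret super_lie_algebra scale gr bracket by (fact assms(1))
  interpret solvable_super_lie_functional scale gr bracket \<phi>
    by unfold_locales (fact assms(2,3))+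
  have "graded_subalgebra UNIV"
    by (simp add: graded_subalgebra_def graded_subspace_UNIV)
  then show ?thesis
    using ex_polarization_in polarization_if_polarization_in_UNIV by blast
qed

end
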